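(* Every finite skew brace $Q$ admits at least one Schur cover; that is, for every finite skew brace $Q$ there exist a skew brace $E$ and an annihilator extension $0\to K\to E\to Q\to 0$ such that $K\subseteq E'$ and $K\simeq M_b(Q)$.
   Context: A skew brace is a triple $(A,+,\circ)$ where $(A,+)$ and $(A,\circ)$ are (not necessarily abelian) groups with $a\circ(b+c)=a\circ b-a+a\circ c$ for all $a,b,c\in A$. Both groups have the same neutral element $0$. Homomorphisms of skew braces preserve both operations. An abelian group is regarded as a (trivial) skew brace with both operations equal to the group operation. The socle is $\mathrm{Soc}(A)=\{a\in A: -a+a\circ b=b\ \forall b\in A\}\cap Z(A,+)$ and the annihilator is $\mathrm{Ann}(A)=\mathrm{Soc}(A)\cap Z(A,\circ)$. The commutator $A'$ is the additive subgroup of $A$ generated by all $[a,b]_+=a+b-a-b$ and all $a*b=-a+a\circ b-b$, $a,b\in A$ (it is an ideal). An annihilator extension of $Q$ by an abelian group $K$ is a short exact sequence of skew braces $0\to K\xrightarrow{\iota}E\xrightarrow{\pi}Q\to0$ with $\iota(K)\subseteq\mathrm{Ann}(E)$; $K$ is identified with $\iota(K)$. For a skew brace $Q$ and a (multiplicative) abelian group $K$, a factor set is a pair $(\alpha,\mu)$ of maps $Q\times Q\to K$ such that for all $x,y,z\in Q$: $\alpha(0,y)=\alpha(x,0)=1$, $\mu(0,y)=\mu(x,0)=1$, $\alpha(y,z)\alpha(x+y,z)^{-1}\alpha(x,y+z)\alpha(x,y)^{-1}=1$, $\mu(y,z)\mu(x\circ y,z)^{-1}\mu(x,y\circ z)\mu(x,y)^{-1}=1$,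 and $\alpha(y,z)\mu(x,y+z)\alpha(-x,x)=\mu(x,z)\alpha(x\circ y,-x)\alpha(x\circ y-x,x\circ z)\mu(x,y)$. Factor sets form a group $Z^2_b(Q,K)$ under pointwise multiplication. For $h:Q\to K$ put $\partial_+h(x,y)=h(y)h(x+y)^{-1}h(x)$ and $\partial_\circ h(x,y)=h(y)h(x\circ y)^{-1}h(x)$. Let $B^2_b(Q,K)=\{(\partial_+h,\partial_\circ h): h:Q\to K,\ h(0)=1\}$ and $H^2_b(Q,K)=Z^2_b(Q,K)/B^2_b(Q,K)$. The Schur multiplier of a finite skew brace $Q$ is $M_b(Q)=H^2_b(Q,\mathbb{C}^\times)$. *)

theory Defs
  imports "HOL-Algebra.Algebra" Complex_Main
begin

text \<open>
  Skew braces are carried by the record type of rings: \<open>\<oplus>\<close> is the additive operation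
  (not assumed commutative) and \<open>\<otimes>\<close> is the circle operation.
\<close>

locale skew_brace = add: group "add_monoid A" + circ: group A
  for A (structure) +
  assumes brace_distrib:
    "\<lbrakk>a \<in> carrier A; b \<in> carrier A; c \<in> carrier A\<rbrakk>
      \<Longrightarrow> a \<otimes> (b \<oplus> c) = ((a \<otimes> b) \<ominus> a) \<oplus> (a \<otimes> c)"

lemma (in skew_brace) one_eq_zero: "\<one> = \<zero>"
proof -
  note closed = add.m_closed[simplified] add.one_closed[simplified]
  have c: "\<one> \<otimes> \<zero> = \<zero>" using closed by simp
  have "\<one> \<otimes> (\<zero> \<oplus> \<zero>) = ((\<one> \<otimes> \<zero>) \<ominus> \<one>) \<oplus> (\<one> \<otimes> \<zero>)"
    using closed by (intro brace_distrib) auto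
  then have "\<zero> = (\<zero> \<ominus> \<one>) \<oplus> \<zero>"
    using c add.l_one[of \<zero>] closed by simp
  then have "\<zero> = \<ominus> \<one>"
    using add.l_one[of "\<ominus> \<one>"] add.r_one[of "\<ominus> \<one>"] add.inv_closed[of \<one>]
    by (simp add: a_minus_def a_inv_def)
  then show ?thesis
    using add.inv_eq_1_iff[of \<one>] by (simp add: a_inv_def)
qed

definition skew_brace_hom ::
  "('a, 'm) ring_scheme \<Rightarrow> ('b, 'n) ring_scheme \<Rightarrow> ('a \<Rightarrow> 'b) set"
  where "skew_brace_hom A B = hom (add_monoid A) (add_monoid B) \<inter> hom A B"

definition trivial_skew_brace :: "('a, 'm) monoid_scheme \<Rightarrow> 'a ring"
  where "trivial_skew_brace K =
    \<lparr>carrier = carrier K, monoid.mult = monoid.mult K, one = one K, ring.zero = one K, ring.add = monoid.mult K\<rparr>"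

lemma trivial_skew_brace: "comm_group K \<Longrightarrow> skew_brace (trivial_skew_brace K)"
proof -
  assume "comm_group K"
  then interpret comm_group K .
  have g: "group \<lparr>carrier = carrier K, monoid.mult = monoid.mult K, one = one K, \<dots> = z\<rparr>" for z :: 'z
    by (rule groupI) (auto simp: m_assoc intro: l_inv_ex)
  have i: "inv\<^bsub>\<lparr>carrier = carrier K, monoid.mult = monoid.mult K, one = one K, \<dots> = z\<rparr>\<^esub> x = inv\<^bsub>K\<^esub> x"
    for x and z :: 'z
    by (simp add: m_inv_def)
  have c: "a \<otimes>\<^bsub>K\<^esub> (b \<otimes>\<^bsub>K\<^esub> c) = a \<otimes>\<^bsub>K\<^esub> b \<otimes>\<^bsub>K\<^esub> inv\<^bsub>K\<^esub> a \<otimes>\<^bsub>K\<^esub> (a \<otimes>\<^bsub>K\<^esub> c)"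
    if "a \<in> carrier K" "b \<in> carrier K" "c \<in> carrier K" for a b c
  proof -
    have "a \<otimes>\<^bsub>K\<^esub> b \<otimes>\<^bsub>K\<^esub> inv\<^bsub>K\<^esub> a = b"
      using that by (simp add: m_comm[of a b] m_assoc)
    then show ?thesis
      using that by (simp add: m_lcomm)
  qed
  show ?thesis
    unfolding skew_brace_def skew_brace_axioms_def
    by (auto simp: trivial_skew_brace_def a_minus_def a_inv_def g i intro: c)
qed

definition group_centre :: "('a, 'm) monoid_scheme \<Rightarrow> 'a set"
  where "group_centre G = {z \<in> carrier G. \<forall>g \<in> carrier G. z \<otimes>\<^bsub>G\<^esub> g = g \<otimes>\<^bsub>G\<^esub> z}"

definition socle :: "('a, 'm) ring_scheme \<Rightarrow> 'a set"
  where "socle A =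
    {a \<in> carrier A. \<forall>b \<in> carrier A. \<ominus>\<^bsub>A\<^esub> a \<oplus>\<^bsub>A\<^esub> (a \<otimes>\<^bsub>A\<^esub> b) = b}
      \<inter> group_centre (add_monoid A)"

definition annihilator :: "('a, 'm) ring_scheme \<Rightarrow> 'a set"
  where "annihilator A = socle A \<inter> group_centre A"

definition add_commutator :: "('a, 'm) ring_scheme \<Rightarrow> 'a \<Rightarrow> 'a \<Rightarrow> 'a"
  where "add_commutator A a b = a \<oplus>\<^bsub>A\<^esub> b \<ominus>\<^bsub>A\<^esub> a \<ominus>\<^bsub>A\<^esub> b"

definition star :: "('a, 'm) ring_scheme \<Rightarrow> 'a \<Rightarrow> 'a \<Rightarrow> 'a"
  where "star A a b = \<ominus>\<^bsub>A\<^esub> a \<oplus>\<^bsub>A\<^esub> (a \<otimes>\<^bsub>A\<^esub> b) \<ominus>\<^bsub>A\<^esub> b"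

definition brace_commutator :: "('a, 'm) ring_scheme \<Rightarrow> 'a set"
  where "brace_commutator A = generate (add_monoid A)
    ({add_commutator A a b | a b. a \<in> carrier A \<and> b \<in> carrier A}
      \<union> {star A a b | a b. a \<in> carrier A \<and> b \<in> carrier A})"

definition annihilator_extension ::
  "('k, 'l) monoid_scheme \<Rightarrow> ('k \<Rightarrow> 'e) \<Rightarrow> ('e, 'm) ring_scheme \<Rightarrow> ('e \<Rightarrow> 'a)
    \<Rightarrow> ('a, 'n) ring_scheme \<Rightarrow> bool"
  where "annihilator_extension K \<iota> E \<pi> Q \<longleftrightarrow>
    comm_group K \<and> skew_brace E \<and> skew_brace Q \<and>
    \<iota> \<in> skew_brace_hom (trivial_skew_brace K) E \<and> inj_on \<iota> (carrier K) \<and>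
    \<pi> \<in> skew_brace_hom E Q \<and> \<pi> ` carrier E = carrier Q \<and>
    \<iota> ` carrier K = kernel (add_monoid E) (add_monoid Q) \<pi> \<and>
    \<iota> ` carrier K \<subseteq> annihilator E"


text \<open>
  Maps defined on the carrier of \<open>Q\<close> (or on pairs from it) are represented by functions that are
  \<^const>\<open>undefined\<close> elsewhere, so that equality of cochains is equality of functions.
\<close>

definition factor_sets ::
  "('a, 'm) ring_scheme \<Rightarrow> ('k, 'l) monoid_scheme \<Rightarrow> (('a \<times> 'a \<Rightarrow> 'k) \<times> ('a \<times> 'a \<Rightarrow> 'k)) set"
  where "factor_sets Q K = {(\<alpha>, \<mu>).
    \<alpha> \<in> carrier Q \<times> carrier Q \<rightarrow>\<^sub>E carrier K \<and>
    \<mu> \<in> carrier Q \<times> carrier Q \<rightarrow>\<^sub>E carrier K \<and>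
    (\<forall>x \<in> carrier Q. \<alpha> (\<zero>\<^bsub>Q\<^esub>, x) = \<one>\<^bsub>K\<^esub> \<and> \<alpha> (x, \<zero>\<^bsub>Q\<^esub>) = \<one>\<^bsub>K\<^esub> \<and>
                     \<mu> (\<zero>\<^bsub>Q\<^esub>, x) = \<one>\<^bsub>K\<^esub> \<and> \<mu> (x, \<zero>\<^bsub>Q\<^esub>) = \<one>\<^bsub>K\<^esub>) \<and>
    (\<forall>x \<in> carrier Q. \<forall>y \<in> carrier Q. \<forall>z \<in> carrier Q.
      \<alpha> (y, z) \<otimes>\<^bsub>K\<^esub> inv\<^bsub>K\<^esub> \<alpha> (x \<oplus>\<^bsub>Q\<^esub> y, z) \<otimes>\<^bsub>K\<^esub> \<alpha> (x, y \<oplus>\<^bsub>Q\<^esub> z) \<otimes>\<^bsub>K\<^esub> inv\<^bsub>K\<^esub> \<alpha> (x, y) = \<one>\<^bsub>K\<^esub> \<and>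
      \<mu> (y, z) \<otimes>\<^bsub>K\<^esub> inv\<^bsub>K\<^esub> \<mu> (x \<otimes>\<^bsub>Q\<^esub> y, z) \<otimes>\<^bsub>K\<^esub> \<mu> (x, y \<otimes>\<^bsub>Q\<^esub> z) \<otimes>\<^bsub>K\<^esub> inv\<^bsub>K\<^esub> \<mu> (x, y) = \<one>\<^bsub>K\<^esub> \<and>
      \<alpha> (y, z) \<otimes>\<^bsub>K\<^esub> \<mu> (x, y \<oplus>\<^bsub>Q\<^esub> z) \<otimes>\<^bsub>K\<^esub> \<alpha> (\<ominus>\<^bsub>Q\<^esub> x, x) =
        \<mu> (x, z) \<otimes>\<^bsub>K\<^esub> \<alpha> (x \<otimes>\<^bsub>Q\<^esub> y, \<ominus>\<^bsub>Q\<^esub> x)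
          \<otimes>\<^bsub>K\<^esub> \<alpha> ((x \<otimes>\<^bsub>Q\<^esub> y) \<ominus>\<^bsub>Q\<^esub> x, x \<otimes>\<^bsub>Q\<^esub> z) \<otimes>\<^bsub>K\<^esub> \<mu> (x, y))}"

definition Z2b ::
  "('a, 'm) ring_scheme \<Rightarrow> ('k, 'l) monoid_scheme \<Rightarrow> (('a \<times> 'a \<Rightarrow> 'k) \<times> ('a \<times> 'a \<Rightarrow> 'k)) monoid"
  where "Z2b Q K =
    (product_group (carrier Q \<times> carrier Q) (\<lambda>_. K) \<times>\<times> product_group (carrier Q \<times> carrier Q) (\<lambda>_. K))
      \<lparr>carrier := factor_sets Q K\<rparr>"

definition d_add ::
  "('a, 'm) ring_scheme \<Rightarrow> ('k, 'l) monoid_scheme \<Rightarrow> ('a \<Rightarrow> 'k) \<Rightarrow> ('a \<times> 'a \<Rightarrow> 'k)"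
  where "d_add Q K h =
    (\<lambda>(x, y) \<in> carrier Q \<times> carrier Q. h y \<otimes>\<^bsub>K\<^esub> inv\<^bsub>K\<^esub> h (x \<oplus>\<^bsub>Q\<^esub> y) \<otimes>\<^bsub>K\<^esub> h x)"

definition d_circ ::
  "('a, 'm) ring_scheme \<Rightarrow> ('k, 'l) monoid_scheme \<Rightarrow> ('a \<Rightarrow> 'k) \<Rightarrow> ('a \<times> 'a \<Rightarrow> 'k)"
  where "d_circ Q K h =
    (\<lambda>(x, y) \<in> carrier Q \<times> carrier Q. h y \<otimes>\<^bsub>K\<^esub> inv\<^bsub>K\<^esub> h (x \<otimes>\<^bsub>Q\<^esub> y) \<otimes>\<^bsub>K\<^esub> h x)"

definition B2b ::
  "('a, 'm) ring_scheme \<Rightarrow> ('k, 'l) monoid_scheme \<Rightarrow> (('a \<times> 'a \<Rightarrow> 'k) \<times> ('a \<times> 'a \<Rightarrow> 'k)) set"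
  where "B2b Q K =
    {(d_add Q K h, d_circ Q K h) | h. h \<in> carrier Q \<rightarrow> carrier K \<and> h \<zero>\<^bsub>Q\<^esub> = \<one>\<^bsub>K\<^esub>}"

definition H2b ::
  "('a, 'm) ring_scheme \<Rightarrow> ('k, 'l) monoid_scheme
    \<Rightarrow> (('a \<times> 'a \<Rightarrow> 'k) \<times> ('a \<times> 'a \<Rightarrow> 'k)) set monoid"
  where "H2b Q K = Z2b Q K Mod B2b Q K"

definition complex_units :: "complex monoid"
  where "complex_units = \<lparr>carrier = - {0}, monoid.mult = (*), one = 1\<rparr>"

definition schur_multiplier ::
  "('a, 'm) ring_scheme \<Rightarrow> (('a \<times> 'a \<Rightarrow> complex) \<times> ('a \<times> 'a \<Rightarrow> complex)) set monoid"
  where "schur_multiplier Q = H2b Q complex_units"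

definition schur_cover ::
  "('k, 'l) monoid_scheme \<Rightarrow> ('k \<Rightarrow> 'e) \<Rightarrow> ('e, 'm) ring_scheme \<Rightarrow> ('e \<Rightarrow> 'a)
    \<Rightarrow> ('a, 'n) ring_scheme \<Rightarrow> bool"
  where "schur_cover K \<iota> E \<pi> Q \<longleftrightarrow>
    annihilator_extension K \<iota> E \<pi> Q \<and>
    \<iota> ` carrier K \<subseteq> brace_commutator E \<and>
    K \<cong> schur_multiplier Q"

end

theory Submission
  imports Defs
begin

text \<open>
  The coboundaries form a divisible subgroup of the group of complex factor sets, and it has finite
  index: some power of every factor set is a coboundary, so every class is represented by a factor
  set with values in a fixed finite group of roots of unity. Hence the projection onto the Schur
  multiplier \<open>M\<close> has a homomorphic section \<open>s\<close>. A finite abelian group \<open>K \<cong> M\<close> carries a perfect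
  pairing \<open>\<beta>\<close> with values in the nonzero complex numbers; as \<open>s m (x, y)\<close> is a character in \<open>m\<close>, it
  equals \<open>\<beta> m (\<alpha> (x, y))\<close> for a unique \<open>\<alpha> (x, y) \<in> K\<close>, and this defines a \<open>K\<close>-valued factor set
  with an extension \<open>E\<close>. If some element of \<open>K\<close> were outside \<open>E'\<close>, a character of \<open>E / E'\<close> would
  separate it from \<open>0\<close>. Its restriction to \<open>K\<close> is \<open>\<beta> m\<close> for some \<open>m\<close>, and its values on a
  transversal exhibit \<open>s m\<close> as a coboundary, which forces \<open>m\<close> to be trivial.
\<close>

text \<open>A mere choice of representatives would not make \<open>s m (x, y)\<close> multiplicative
  in \<open>m\<close>. Divisibility supplies the homomorphic section: the identity on the
  coboundaries extends to a retraction of the whole group of factor sets. As the index is finite,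
  that extension adjoins one coset representative at a time, by finite induction instead of Zorn's
  lemma. The natural kernel of the cover is the character group of \<open>M\<close>. A symmetric
  perfect pairing identifies it, non-canonically, with \<open>K\<close>, and it also supplies the
  characters that separate points of \<open>E / E'\<close>. Two points are specific to skew braces.
  A character of the additive group of \<open>E / E'\<close> respects the circle operation as well,
  because every \<open>star\<close> element lies in \<open>E'\<close>. And the exponent that makes a
  factor set a coboundary is \<open>n * n\<close> with \<open>n = card (carrier A)\<close>: one
  factor \<open>n\<close> trivialises the additive component, but the coboundary that achieves this
  also changes the circle component, and a second factor \<open>n\<close> kills what is left
  there.\<close>

section \<open>Extending homomorphisms into divisible groups\<close>

text \<open>The value at \<open>x\<close> has to be an \<open>n\<close>-th root of
  \<open>f (x [^] n)\<close>, where \<open>n\<close> is the least positive exponent that brings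
  \<open>x\<close> into \<open>L\<close>; divisibility provides one. The exponents with this
  property are the multiples of \<open>n\<close>, so no further constraint arises.\<close>

lemma (in comm_group) hom_extend_step:
  assumes D: "comm_group D"
    and div: "\<And>d n::nat. d \<in> carrier D \<Longrightarrow> n > 0 \<Longrightarrow> \<exists>e\<in>carrier D. e [^]\<^bsub>D\<^esub> n = d"
    and L: "subgroup L G" and f: "f \<in> hom (G\<lparr>carrier := L\<rparr>) D"
    and x: "x \<in> carrier G" and tors: "\<exists>n::nat. n > 0 \<and> x [^] n \<in> L"
  shows "\<exists>L' f'. subgroup L' G \<and> L \<subseteq> L' \<and> x \<in> L' \<and> f' \<in> hom (G\<lparr>carrier := L'\<rparr>) D \<and>
    (\<forall>y\<in>L. f' y = f y)"
proof -
  interpret D: comm_group D by fact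
  interpret L: subgroup L G by fact
  have f_closed: "f l \<in> carrier D" if "l \<in> L" for l
    using f that by (auto simp: hom_def)
  have f_mult: "f (l \<otimes> l') = f l \<otimes>\<^bsub>D\<^esub> f l'" if "l \<in> L" "l' \<in> L" for l l'
    using f that by (auto simp: hom_def)
  have f_pow: "f (l [^] q) = f l [^]\<^bsub>D\<^esub> q" if "l \<in> L" for l and q :: int
  proof -
    interpret h: group_hom "G\<lparr>carrier := L\<rparr>" D f
      using f L.subgroup_is_group[OF group_axioms]
      by (simp add: group_hom_def group_hom_axioms_def)
    show ?thesis
      using h.hom_int_pow[of l q] that int_pow_consistent[OF L, of l q] by simp
  qed
  define n where "n = (LEAST n::nat. n > 0 \<and> x [^] n \<in> L)"
  have n: "n > 0" "x [^] n \<in> L"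
    using LeastI_ex[OF tors] by (auto simp: n_def)
  have n_least: "n \<le> k" if "k > 0" "x [^] k \<in> L" for k :: nat
    using that by (auto simp: n_def intro: Least_le)
  have n_dvd: "int n dvd k" if "x [^] k \<in> L" for k :: int
  proof -
    define r where "r = nat (k mod int n)"
    have r: "k mod int n = int r" "r < n"
      using n(1) by (auto simp: r_def nat_less_iff)
    have "x [^] int r = x [^] (k - int n * (k div int n))"
      using r(1) by (simp flip: r(1) add: minus_mult_div_eq_mod)
    also have "\<dots> = x [^] k \<otimes> inv ((x [^] n) [^] (k div int n))"
      using x by (simp add: int_pow_diff flip: int_pow_pow int_pow_int)
    also have "\<dots> \<in> L"
      using that n(2) L by (simp add: subgroup_int_pow_closed)
    finally have "x [^] r \<in> L"
      by (simp add: int_pow_int)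
    then have "r = 0"
      using n_least[of r] r(2) by fastforce
    then show ?thesis
      using r(1) by (simp add: dvd_eq_mod_eq_0)
  qed
  obtain d where d: "d \<in> carrier D" "d [^]\<^bsub>D\<^esub> n = f (x [^] n)"
    using div[OF f_closed[OF n(2)] n(1)] by blast
  have f_xpow: "f (x [^] k) = d [^]\<^bsub>D\<^esub> k" if xk: "x [^] k \<in> L" for k :: int
  proof -
    from n_dvd[OF xk] obtain q where q: "k = int n * q" by blast
    have "f (x [^] k) = f ((x [^] n) [^] q)"
      using x by (simp add: q int_pow_int flip: int_pow_pow)
    also have "\<dots> = d [^]\<^bsub>D\<^esub> k"
      using d by (simp add: f_pow n(2) q int_pow_int flip: D.int_pow_pow)
    finally show ?thesis .
  qed
  \<comment> \<open>Two representations of one element differ by a power of \<open>x\<close> that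
    lies in \<open>L\<close>, and on such powers \<open>f\<close> already agrees with the powers of
    \<open>d\<close>.\<close>
  have wd: "f l \<otimes>\<^bsub>D\<^esub> d [^]\<^bsub>D\<^esub> k = f l' \<otimes>\<^bsub>D\<^esub> d [^]\<^bsub>D\<^esub> k'"
    if l: "l \<in> L" "l' \<in> L" and eq: "l \<otimes> x [^] k = l' \<otimes> x [^] k'" for l l' and k k' :: int
  proof -
    have lc: "l \<in> carrier G" "l' \<in> carrier G" using l by auto
    have *: "x [^] (k' - k) = inv l' \<otimes> l"
    proof -
      have "inv l' \<otimes> l = inv l' \<otimes> (l \<otimes> x [^] k) \<otimes> inv (x [^] k)"
        using x lc by (simp add: m_assoc)
      also have "\<dots> = x [^] k' \<otimes> inv (x [^] k)"
        unfolding eq using x lc by (simp add: m_assoc[symmetric])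
      finally show ?thesis
        using x by (simp add: int_pow_diff)
    qed
    then have in_L: "x [^] (k' - k) \<in> L"
      using l by simp
    have "f l = f (l' \<otimes> x [^] (k' - k))"
      unfolding * using lc by (simp add: m_assoc[symmetric])
    also have "\<dots> = f l' \<otimes>\<^bsub>D\<^esub> d [^]\<^bsub>D\<^esub> (k' - k)"
      using f_mult[OF l(2) in_L] f_xpow[OF in_L] by simp
    finally have "f l \<otimes>\<^bsub>D\<^esub> d [^]\<^bsub>D\<^esub> k = f l' \<otimes>\<^bsub>D\<^esub> (d [^]\<^bsub>D\<^esub> (k' - k) \<otimes>\<^bsub>D\<^esub> d [^]\<^bsub>D\<^esub> k)"
      using f_closed[OF l(2)] d(1) by (simp add: D.m_assoc)
    then show ?thesis
      using d(1) by (simp flip: D.int_pow_mult)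
  qed
  define L' where "L' = {l \<otimes> x [^] k | l k::int. l \<in> L}"
  define f' where "f' u = (SOME v. \<exists>l\<in>L. \<exists>k::int. u = l \<otimes> x [^] k \<and> v = f l \<otimes>\<^bsub>D\<^esub> d [^]\<^bsub>D\<^esub> k)" for u
  have f'_eq: "f' (l \<otimes> x [^] k) = f l \<otimes>\<^bsub>D\<^esub> d [^]\<^bsub>D\<^esub> k" if "l \<in> L" for l and k :: int
    unfolding f'_def
  proof (rule some_equality)
    show "\<exists>l'\<in>L. \<exists>k'::int. l \<otimes> x [^] k = l' \<otimes> x [^] k' \<and> f l \<otimes>\<^bsub>D\<^esub> d [^]\<^bsub>D\<^esub> k = f l' \<otimes>\<^bsub>D\<^esub> d [^]\<^bsub>D\<^esub> k'"
      using that by blast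
    fix v assume "\<exists>l'\<in>L. \<exists>k'::int. l \<otimes> x [^] k = l' \<otimes> x [^] k' \<and> v = f l' \<otimes>\<^bsub>D\<^esub> d [^]\<^bsub>D\<^esub> k'"
    then obtain l' and k' :: int where "l' \<in> L" "l \<otimes> x [^] k = l' \<otimes> x [^] k'" "v = f l' \<otimes>\<^bsub>D\<^esub> d [^]\<^bsub>D\<^esub> k'"
      by auto
    then show "v = f l \<otimes>\<^bsub>D\<^esub> d [^]\<^bsub>D\<^esub> k"
      using wd[OF that, of l' k k'] by simp
  qed
  have L'_I: "u \<in> L'" if "l \<in> L" "u = l \<otimes> x [^] k" for u l and k :: int
    using that by (auto simp: L'_def)
  have mult: "(l \<otimes> x [^] k) \<otimes> (l' \<otimes> x [^] k') = (l \<otimes> l') \<otimes> x [^] (k + k')"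
    if "l \<in> L" "l' \<in> L" for l l' and k k' :: int
    using that x L.subset by (simp add: int_pow_mult m_ac subset_iff)
  have L_sub: "L \<subseteq> L'"
  proof
    fix l assume l: "l \<in> L"
    then show "l \<in> L'" by (intro L'_I[of l _ 0]) auto
  qed
  have x_in: "x \<in> L'"
    using x by (intro L'_I[of \<one> _ 1]) auto
  have "subgroup L' G"
  proof
    show "L' \<subseteq> carrier G"
      using x L.subset by (auto simp: L'_def)
    show "\<one> \<in> L'" using L_sub by auto
    show "u \<otimes> v \<in> L'" if "u \<in> L'" "v \<in> L'" for u v
    proof -
      from that obtain l l' and k k' :: int
        where "l \<in> L" "u = l \<otimes> x [^] k" "l' \<in> L" "v = l' \<otimes> x [^] k'"
        by (auto simp: L'_def)
      then show ?thesis
        by (intro L'_I[of "l \<otimes> l'" _ "k + k'"]) (auto simp: mult)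
    qed
    show "inv u \<in> L'" if "u \<in> L'" for u
    proof -
      from that obtain l and k :: int where l: "l \<in> L" "u = l \<otimes> x [^] k"
        by (auto simp: L'_def)
      have "inv u = inv l \<otimes> x [^] (- k)"
        using l x L.subset by (simp add: inv_mult int_pow_neg subset_iff)
      then show ?thesis
        using l by (intro L'_I[of "inv l"]) auto
    qed
  qed
  moreover have "f' \<in> hom (G\<lparr>carrier := L'\<rparr>) D"
  proof (rule homI)
    show "f' u \<in> carrier D" if "u \<in> carrier (G\<lparr>carrier := L'\<rparr>)" for u
      using that d(1) by (auto simp: L'_def f'_eq f_closed)
    show "f' (u \<otimes>\<^bsub>G\<lparr>carrier := L'\<rparr>\<^esub> v) = f' u \<otimes>\<^bsub>D\<^esub> f' v"
      if "u \<in> carrier (G\<lparr>carrier := L'\<rparr>)" "v \<in> carrier (G\<lparr>carrier := L'\<rparr>)" for u v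
    proof -
      from that obtain l l' and k k' :: int
        where l: "l \<in> L" "u = l \<otimes> x [^] k" "l' \<in> L" "v = l' \<otimes> x [^] k'"
        by (auto simp: L'_def)
      show ?thesis
        using l d(1) f_closed
        by (simp add: mult f'_eq f_mult D.int_pow_mult D.m_ac)
    qed
  qed
  moreover have "f' l = f l" if l: "l \<in> L" for l
    using f'_eq[OF l, of 0] l f_closed by simp
  ultimately show ?thesis
    using L_sub x_in by blast
qed

text \<open>\<open>F\<close> is a finite set meeting every coset of \<open>H\<close>. Its elements
  are adjoined one by one; torsion modulo \<open>H\<close> persists modulo each larger subgroup, so
  the one-element step always applies.\<close>

lemma (in comm_group) hom_extend:
  assumes D: "comm_group D"
    and div: "\<And>d n::nat. d \<in> carrier D \<Longrightarrow> n > 0 \<Longrightarrow> \<exists>e\<in>carrier D. e [^]\<^bsub>D\<^esub> n = d"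
    and H: "subgroup H G" and f: "f \<in> hom (G\<lparr>carrier := H\<rparr>) D"
    and F: "finite F" "F \<subseteq> carrier G" and tors: "\<And>x. x \<in> F \<Longrightarrow> \<exists>n::nat. n > 0 \<and> x [^] n \<in> H"
    and gen: "\<And>x. x \<in> carrier G \<Longrightarrow> \<exists>y\<in>F. \<exists>h\<in>H. x = y \<otimes> h"
  shows "\<exists>f'\<in>hom G D. \<forall>y\<in>H. f' y = f y"
proof -
  have "\<exists>L f'. subgroup L G \<and> H \<subseteq> L \<and> F \<subseteq> L \<and> f' \<in> hom (G\<lparr>carrier := L\<rparr>) D \<and> (\<forall>y\<in>H. f' y = f y)"
    using F tors
  proof (induction F rule: finite_induct)
    case empty
    then show ?case using H f by auto
  next
    case (insert x F)
    then obtain L f' where L: "subgroup L G" "H \<subseteq> L" "F \<subseteq> L" "f' \<in> hom (G\<lparr>carrier := L\<rparr>) D"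
      "\<forall>y\<in>H. f' y = f y" by auto
    have "x \<in> carrier G" "\<exists>n::nat. n > 0 \<and> x [^] n \<in> L"
      using insert.prems L(2) by blast+
    from hom_extend_step[OF D div L(1,4) this] obtain L' f'' where
      "subgroup L' G" "L \<subseteq> L'" "x \<in> L'" "f'' \<in> hom (G\<lparr>carrier := L'\<rparr>) D" "\<forall>y\<in>L. f'' y = f' y"
      by auto
    then show ?case
      using L by (intro exI[of _ L'] exI[of _ f'']) auto
  qed
  then obtain L f' where L: "subgroup L G" "H \<subseteq> L" "F \<subseteq> L" "f' \<in> hom (G\<lparr>carrier := L\<rparr>) D"
    "\<forall>y\<in>H. f' y = f y" by blast
  have "L = carrier G"
    using gen L(1-3) subgroup.subset[OF L(1)] subgroup.m_closed[OF L(1)] by blast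
  then show ?thesis
    using L by auto
qed

lemma (in comm_group) subgroup_is_comm_group:
  assumes "subgroup H G"
  shows "comm_group (G\<lparr>carrier := H\<rparr>)"
proof -
  interpret H: group "G\<lparr>carrier := H\<rparr>"
    using subgroup.subgroup_is_group[OF assms group_axioms] .
  show ?thesis
    using subgroup.subset[OF assms] by (intro H.group_comm_groupI) (auto intro: m_comm)
qed

text \<open>A divisible subgroup is a direct factor. If \<open>r\<close> is a retraction onto
  \<open>B\<close>, then \<open>x \<otimes> inv r x\<close> stays in the coset of \<open>x\<close>,
  is multiplicative, and is trivial on \<open>B\<close>, so it depends only on the coset.\<close>

lemma (in comm_group) ex_hom_section:
  assumes B: "subgroup B G"
    and div: "\<And>b n::nat. b \<in> B \<Longrightarrow> n > 0 \<Longrightarrow> \<exists>c\<in>B. c [^] n = b"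
    and F: "finite F" "F \<subseteq> carrier G" and tors: "\<And>x. x \<in> F \<Longrightarrow> \<exists>n::nat. n > 0 \<and> x [^] n \<in> B"
    and gen: "\<And>x. x \<in> carrier G \<Longrightarrow> \<exists>y\<in>F. \<exists>b\<in>B. x = y \<otimes> b"
  shows "\<exists>s\<in>hom (G Mod B) G. \<forall>M\<in>carrier (G Mod B). s M \<in> M"
proof -
  interpret B: subgroup B G by fact
  interpret N: normal B G using subgroup_imp_normal[OF B] .
  have "\<exists>r\<in>hom G (G\<lparr>carrier := B\<rparr>). \<forall>y\<in>B. r y = id y"
  proof (rule hom_extend[OF subgroup_is_comm_group[OF B] _ B _ F tors gen])
    show "\<exists>e\<in>carrier (G\<lparr>carrier := B\<rparr>). e [^]\<^bsub>G\<lparr>carrier := B\<rparr>\<^esub> n = d"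
      if "d \<in> carrier (G\<lparr>carrier := B\<rparr>)" "n > 0" for d and n :: nat
      using div[of d n] that by (simp flip: nat_pow_consistent)
    show "id \<in> hom (G\<lparr>carrier := B\<rparr>) (G\<lparr>carrier := B\<rparr>)"
      by (auto simp: hom_def)
  qed
  then obtain r where r: "r \<in> hom G (G\<lparr>carrier := B\<rparr>)" "\<And>y. y \<in> B \<Longrightarrow> r y = y"
    by auto
  have rB: "r x \<in> B" if "x \<in> carrier G" for x
    using r(1) that by (auto simp: hom_def)
  have r_mult: "r (x \<otimes> y) = r x \<otimes> r y" if "x \<in> carrier G" "y \<in> carrier G" for x y
    using r(1) that by (auto simp: hom_def)
  define t where "t x = x \<otimes> inv r x" for x
  have t_closed: "t x \<in> carrier G" if "x \<in> carrier G" for x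
    using rB[OF that] that by (simp add: t_def)
  have t_mult: "t (x \<otimes> y) = t x \<otimes> t y" if "x \<in> carrier G" "y \<in> carrier G" for x y
    using that rB[of x] rB[of y] by (simp add: t_def r_mult inv_mult m_ac)
  have t_B: "t b = \<one>" if "b \<in> B" for b
    using that by (simp add: t_def r(2))
  have t_coset: "t y = t x" if "x \<in> carrier G" "y \<in> B #> x" for x y
    using that t_closed[of x] by (auto simp: r_coset_def t_mult t_B)
  have t_in: "t x \<in> B #> x" if "x \<in> carrier G" for x
    using that rB[OF that] by (auto simp: r_coset_def t_def m_comm intro!: bexI[of _ "inv r x"])
  define s where "s M = t (SOME x. x \<in> M)" for M
  have s_coset: "s (B #> x) = t x" if "x \<in> carrier G" for x
    unfolding s_def using t_coset[OF that] rcos_self[OF that B] by (metis someI)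
  have "s \<in> hom (G Mod B) G"
    by (rule homI) (auto simp: carrier_FactGroup s_coset t_closed t_mult N.rcos_sum)
  moreover have "s M \<in> M" if "M \<in> carrier (G Mod B)" for M
    using that by (auto simp: carrier_FactGroup s_coset t_in)
  ultimately show ?thesis by blast
qed

section \<open>The exponent of a finite abelian group is the order of an element\<close>

lemma (in comm_group) ord_mult_coprime:
  assumes x: "x \<in> carrier G" and y: "y \<in> carrier G" and co: "coprime (ord x) (ord y)"
  shows "ord (x \<otimes> y) = ord x * ord y"
proof (rule dvd_antisym)
  show "ord (x \<otimes> y) dvd ord x * ord y"
    using x y by (rule abelian_ord_mul_divides)
  have *: "ord a dvd ord (a \<otimes> b)" if "a \<in> carrier G" "b \<in> carrier G" "coprime (ord a) (ord b)" for a b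
  proof -
    let ?k = "ord (a \<otimes> b)"
    \<comment> \<open>The exponent is a multiple of \<open>ord b\<close>, which removes
      \<open>b\<close>, and a multiple of \<open>?k\<close>, which kills the product.\<close>
    have "a [^] (?k * ord b) = a [^] (?k * ord b) \<otimes> b [^] (?k * ord b)"
      using that by (simp add: pow_eq_id[THEN iffD2])
    also have "\<dots> = \<one>"
      using that by (simp add: pow_mult_distrib[OF m_comm, symmetric] pow_eq_id)
    finally have "ord a dvd ?k * ord b"
      using that(1) by (simp add: pow_eq_id)
    then show ?thesis
      using that(3) by (simp add: coprime_dvd_mult_left_iff)
  qed
  show "ord x * ord y dvd ord (x \<otimes> y)"
    using *[OF x y co] *[OF y x] co x y by (simp add: divides_mult m_comm coprime_commute)
qed

text \<open>Any element of maximal order will do: if some order did not divide it, a prime power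
  could be exchanged to build an element of larger order.\<close>

lemma (in comm_group) ex_ord_exponent:
  assumes fin: "finite (carrier G)"
  obtains g where "g \<in> carrier G" "\<And>x. x \<in> carrier G \<Longrightarrow> x [^] ord g = \<one>"
proof -
  have ne: "carrier G \<noteq> {}" using one_closed by blast
  obtain g where g: "g \<in> carrier G" and max: "\<And>x. x \<in> carrier G \<Longrightarrow> ord x \<le> ord g"
  proof -
    have "Max (ord ` carrier G) \<in> ord ` carrier G"
      using fin ne by (intro Max_in) auto
    then obtain g where "g \<in> carrier G" "ord g = Max (ord ` carrier G)"
      by force
    then show ?thesis
      using fin by (intro that[of g]) auto
  qed
  have "ord x dvd ord g" if x: "x \<in> carrier G" for x
  proof (rule ccontr)
    assume not_dvd: "\<not> ord x dvd ord g"
    have pos: "ord x > 0" "ord g > 0"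
      using ord_ge_1[OF fin] x g by (force simp: Suc_le_eq)+
    obtain p where p: "Factorial_Ring.prime p" "multiplicity p (ord x) > multiplicity p (ord g)"
      using not_dvd pos multiplicity_le_imp_dvd[of "ord x" "ord g"] by (metis not_le gr_implies_not0)
    let ?a = "multiplicity p (ord g)" and ?b = "multiplicity p (ord x)"
    obtain u where u: "ord g = p ^ ?a * u" "\<not> p dvd u"
      using multiplicity_decompose'[of "ord g" p] pos p(1) by (metis not_prime_unit gr_implies_not0)
    obtain v where v: "ord x = p ^ ?b * v" "\<not> p dvd v"
      using multiplicity_decompose'[of "ord x" p] pos p(1) by (metis not_prime_unit gr_implies_not0)
    have p0: "p > 0" using p(1) by (simp add: prime_gt_0_nat)
    have v0: "v \<noteq> 0" using v(2) by (metis dvd_0_right)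
    \<comment> \<open>\<open>g'\<close> loses the whole \<open>p\<close>-part of \<open>g\<close>,
      and \<open>x'\<close> retains only the larger \<open>p\<close>-part of \<open>x\<close>. Their
      orders are coprime, so they multiply.\<close>
    define g' where "g' = g [^] (p ^ ?a)"
    define x' where "x' = x [^] v"
    have g': "g' \<in> carrier G" "ord g' = u"
    proof -
      show "g' \<in> carrier G" using g by (simp add: g'_def)
      have "p ^ ?a dvd ord g" using u(1) by (metis dvd_triv_left)
      then have "ord g' = ord g div p ^ ?a"
        unfolding g'_def using g p0 by (intro ord_pow) auto
      also have "\<dots> = u"
        by (subst u(1)) (use p0 in simp)
      finally show "ord g' = u" .
    qed
    have x': "x' \<in> carrier G" "ord x' = p ^ ?b"
    proof -
      show "x' \<in> carrier G" using x by (simp add: x'_def)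
      have "v dvd ord x" using v(1) by (metis dvd_triv_right)
      then have "ord x' = ord x div v"
        unfolding x'_def using x v0 by (intro ord_pow) auto
      also have "\<dots> = p ^ ?b"
        by (subst v(1)) (use v0 in simp)
      finally show "ord x' = p ^ ?b" .
    qed
    have co: "coprime (ord x') (ord g')"
      using u(2) p(1) by (simp add: x' g' prime_imp_coprime)
    have "ord (x' \<otimes> g') = p ^ ?b * u"
      using ord_mult_coprime[OF x'(1) g'(1) co] by (simp add: x' g')
    moreover have "p ^ ?b * u > p ^ ?a * u"
    proof -
      have "u > 0" using u(2) by (metis dvd_0_right gr0I)
      moreover have "p ^ ?b > p ^ ?a"
        using p(2) prime_gt_1_nat[OF p(1)] by (simp add: power_strict_increasing)
      ultimately show ?thesis by simp
    qed
    ultimately show False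
      using max[of "x' \<otimes> g'"] x'(1) g'(1) u(1) by simp
  qed
  with g show ?thesis
    by (intro that[of g]) (auto simp: pow_eq_id)
qed

section \<open>Perfect pairings on finite abelian groups\<close>

lemma complex_units_simps [simp]:
  "carrier complex_units = - {0}" "x \<otimes>\<^bsub>complex_units\<^esub> y = x * y" "\<one>\<^bsub>complex_units\<^esub> = 1"
  by (simp_all add: complex_units_def)

lemma comm_group_complex_units: "comm_group complex_units"
proof (rule comm_groupI; simp)
  fix x :: complex assume "x \<noteq> 0"
  then show "\<exists>y\<in>- {0}. y * x = 1"
    by (intro bexI[of _ "inverse x"]) auto
qed

interpretation complex_units: comm_group complex_units
  by (rule comm_group_complex_units)

lemma inv_complex_units [simp]: "x \<noteq> 0 \<Longrightarrow> inv\<^bsub>complex_units\<^esub> x = inverse x"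
  by (rule complex_units.inv_equality) auto

lemma pow_complex_units [simp]: "x [^]\<^bsub>complex_units\<^esub> (n::nat) = x ^ n"
  by (induction n) (auto simp: nat_pow_def mult.commute)

lemma complex_units_divisible:
  assumes "d \<in> carrier complex_units" "n > 0"
  shows "\<exists>e\<in>carrier complex_units. e [^]\<^bsub>complex_units\<^esub> (n::nat) = d"
proof -
  obtain e where "e ^ n = d"
  proof
    show "(of_real (root n (cmod d)) * cis (Arg d / n)) ^ n = d"
      using assms by (simp add: power_mult_distrib DeMoivre cis_Arg flip: of_real_power)
        (simp add: complex_sgn_def scaleR_conv_of_real)
  qed
  then show ?thesis
    using assms by (intro bexI[of _ e]) (auto simp: zero_power)
qed

lemma root_of_unity_eq_power:
  assumes "n > 0" "z ^ n = (1::complex)"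
  obtains k where "z = cis (2 * pi / n) ^ k"
proof -
  have "z \<in> (\<lambda>k. cis (2 * pi * real k / real n)) ` {..<n}"
    using bij_betw_roots_unity[OF assms(1)] assms(2) by (auto simp: bij_betw_def)
  then show ?thesis
    using that by (auto simp: DeMoivre mult.commute)
qed

lemma cis_power_eq_1_iff:
  fixes n k :: nat
  assumes "n > 0"
  shows "cis (2 * pi / n) ^ k = 1 \<longleftrightarrow> n dvd k"
proof -
  have "cis (2 * pi / n) ^ k = cis (2 * pi * real (k mod n) / n)"
  proof -
    have *: "cis (2 * pi / n) ^ n = 1"
      using assms by (simp add: DeMoivre)
    have "cis (2 * pi / n) ^ k = cis (2 * pi / n) ^ (n * (k div n) + k mod n)" by simp
    also have "\<dots> = cis (2 * pi / n) ^ (k mod n)"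
      by (simp only: power_add power_mult * power_one mult_1_left)
    also have "\<dots> = cis (2 * pi * real (k mod n) / n)"
      by (simp add: DeMoivre mult.commute)
    finally show ?thesis .
  qed
  moreover have "cis (2 * pi * real (k mod n) / n) = 1 \<longleftrightarrow> k mod n = 0"
    using inj_on_eq_iff[OF bij_betw_imp_inj_on[OF bij_betw_roots_unity[OF assms]], of "k mod n" 0] assms
    by simp
  ultimately show ?thesis by auto
qed

section \<open>Self-duality of finite abelian groups\<close>

text \<open>The last two clauses say that \<open>x \<mapsto> \<beta> x\<close> has trivial kernel
  and reaches every character, so it identifies \<open>G\<close> with its character group. Symmetry
  makes the pairing multiplicative in the first argument too.\<close>

definition perfect_pairing :: "('a, 'b) monoid_scheme \<Rightarrow> ('a \<Rightarrow> 'a \<Rightarrow> complex) \<Rightarrow> bool"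
  where "perfect_pairing G \<beta> \<longleftrightarrow>
    (\<forall>x\<in>carrier G. \<beta> x \<in> hom G complex_units) \<and>
    (\<forall>x\<in>carrier G. \<forall>y\<in>carrier G. \<beta> x y = \<beta> y x) \<and>
    (\<forall>x\<in>carrier G. (\<forall>y\<in>carrier G. \<beta> x y = 1) \<longrightarrow> x = \<one>\<^bsub>G\<^esub>) \<and>
    (\<forall>\<psi>\<in>hom G complex_units. \<exists>x\<in>carrier G. \<forall>y\<in>carrier G. \<psi> y = \<beta> x y)"

text \<open>Sending \<open>g\<close> to a primitive root of unity of order \<open>ord g\<close> is a
  faithful character of the cyclic group of \<open>g\<close>, and it extends because the target is
  divisible. Since \<open>ord g\<close> is the exponent of \<open>G\<close>, every character of
  \<open>G\<close> takes values among the powers of \<open>\<chi> g\<close>.\<close>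

lemma (in comm_group) cyclic_split:
  assumes fin: "finite (carrier G)"
  obtains g \<chi> where "g \<in> carrier G" "\<chi> \<in> hom G complex_units" "\<chi> g = cis (2 * pi / ord g)"
    "\<And>x. x \<in> carrier G \<Longrightarrow> x [^] ord g = \<one>"
proof -
  obtain g where g: "g \<in> carrier G" "\<And>x. x \<in> carrier G \<Longrightarrow> x [^] ord g = \<one>"
    using ex_ord_exponent[OF fin] by blast
  define n where "n = ord g"
  have n: "n > 0" using ord_ge_1[OF fin g(1)] by (simp add: n_def)
  define \<zeta> where "\<zeta> = cis (2 * pi / n)"
  define S where "S = {g [^] k | k::nat. True}"
  \<comment> \<open>The exponent of \<open>u\<close> is determined only modulo \<open>n\<close>; as
    \<open>\<zeta>\<close> has order \<open>n\<close>, the choice does not affect the value.\<close>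
  define f where "f u = \<zeta> ^ (SOME k. u = g [^] (k::nat))" for u
  have \<zeta>_eq: "\<zeta> ^ i = \<zeta> ^ j" if eq: "g [^] i = g [^] j" for i j :: nat
  proof -
    have *: "\<zeta> ^ i = \<zeta> ^ j" if "i \<le> j" and eq: "g [^] i = g [^] j" for i j :: nat
    proof -
      have "g [^] i \<otimes> g [^] (j - i) = g [^] j"
        using that(1) g(1) by (simp add: nat_pow_mult)
      then have "g [^] i \<otimes> g [^] (j - i) = g [^] i \<otimes> \<one>"
        using eq g(1) by simp
      then have "g [^] (j - i) = \<one>"
        using g(1) by simp
      then have "n dvd j - i"
        using g(1) by (simp add: pow_eq_id n_def)
      then have "\<zeta> ^ (j - i) = 1"
        using cis_power_eq_1_iff[OF n] by (simp add: \<zeta>_def)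
      then show ?thesis
        using that(1) power_add[of \<zeta> i "j - i"] by simp
    qed
    show ?thesis
      using *[OF _ eq] *[OF _ eq[symmetric]] by (metis nat_le_linear)
  qed
  have f_eq: "f (g [^] k) = \<zeta> ^ k" for k :: nat
  proof -
    have "g [^] k = g [^] (SOME k'. g [^] k = g [^] (k'::nat))"
      by (rule someI[of _ k]) (rule refl)
    then show ?thesis
      unfolding f_def by (rule \<zeta>_eq[OF sym])
  qed
  have S_gen: "S = generate G {g}"
    using generate_pow_on_finite_carrier[OF fin g(1)] by (simp add: S_def)
  have S: "subgroup S G"
    unfolding S_gen using g(1) by (intro generate_is_subgroup) auto
  have f_hom: "f \<in> hom (G\<lparr>carrier := S\<rparr>) complex_units"
    by (rule homI) (auto simp: S_def f_eq \<zeta>_def nat_pow_mult[OF g(1)] power_add)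
  have "\<exists>\<chi>\<in>hom G complex_units. \<forall>y\<in>S. \<chi> y = f y"
  proof (rule hom_extend[OF comm_group_complex_units complex_units_divisible S f_hom fin order_refl])
    show "\<exists>m::nat. m > 0 \<and> x [^] m \<in> S" if "x \<in> carrier G" for x
      using n g(2)[OF that] subgroup.one_closed[OF S] by (intro exI[of _ n]) (auto simp: n_def)
    show "\<exists>y\<in>carrier G. \<exists>h\<in>S. x = y \<otimes> h" if "x \<in> carrier G" for x
      using that subgroup.one_closed[OF S] by (intro bexI[of _ x] bexI[of _ \<one>]) auto
  qed auto
  then obtain \<chi> where "\<chi> \<in> hom G complex_units" "\<forall>y\<in>S. \<chi> y = f y"
    by blast
  moreover have "g = g [^] (1::nat)"
    using g(1) by simp
  then have "g \<in> S"
    unfolding S_def by blast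
  moreover have "f g = \<zeta>"
    using f_eq[of 1] g(1) by simp
  ultimately show ?thesis
    using g by (intro that[of g \<chi>]) (auto simp: \<zeta>_def n_def)
qed

text \<open>
  The pairing is built by splitting off a cyclic factor generated by an element \<open>g\<close> of maximal
  order: a faithful character of \<open>\<langle>g\<rangle>\<close> extends to \<open>\<chi>\<close> on the whole group, and its kernel is a
  complement of \<open>\<langle>g\<rangle>\<close>.
\<close>

lemma (in comm_group) perfect_pairing_step:
  assumes fin: "finite (carrier G)"
    and IH: "\<And>H. subgroup H G \<Longrightarrow> card H < card (carrier G) \<Longrightarrow>
      \<exists>\<gamma>. perfect_pairing (G\<lparr>carrier := H\<rparr>) \<gamma>"
  shows "\<exists>\<beta>. perfect_pairing G \<beta>"
proof (cases "carrier G = {\<one>}")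
  case True
  have "\<psi> \<one> = 1" if "\<psi> \<in> hom G complex_units" for \<psi>
    using hom_one[OF that group_axioms complex_units.group_axioms] by simp
  with True have "perfect_pairing G (\<lambda>_ _. 1)"
    by (auto simp: perfect_pairing_def intro!: homI)
  then show ?thesis by blast
next
  case nontriv: False
  obtain g \<chi> where g: "g \<in> carrier G" and \<chi>: "\<chi> \<in> hom G complex_units" "\<chi> g = cis (2 * pi / ord g)"
    and exponent: "\<And>x. x \<in> carrier G \<Longrightarrow> x [^] ord g = \<one>"
    using cyclic_split[OF fin] by metis
  define n where "n = ord g"
  have n: "n > 0" using ord_ge_1[OF fin g] by (simp add: n_def)
  define \<zeta> where "\<zeta> = cis (2 * pi / n)"
  have \<chi>g: "\<chi> g = \<zeta>" using \<chi>(2) by (simp add: \<zeta>_def n_def)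
  have hom_mult': "\<psi> (x \<otimes> y) = \<psi> x * \<psi> y" if "\<psi> \<in> hom G complex_units" "x \<in> carrier G" "y \<in> carrier G" for \<psi> x y
    using hom_mult[OF that] by simp
  have hom_pow': "\<psi> (x [^] k) = \<psi> x ^ k" if "\<psi> \<in> hom G complex_units" "x \<in> carrier G" for \<psi> x and k :: nat
    using hom_nat_pow[OF that group_axioms complex_units.group_axioms] by simp
  have hom_one': "\<psi> \<one> = 1" if "\<psi> \<in> hom G complex_units" for \<psi>
    using hom_one[OF that group_axioms complex_units.group_axioms] by simp
  have root: "\<exists>k. \<psi> x = \<zeta> ^ k" if "\<psi> \<in> hom G complex_units" "x \<in> carrier G" for \<psi> x
  proof -
    have "\<psi> x ^ n = \<psi> (x [^] n)"
      using that by (simp add: hom_pow')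
    also have "\<dots> = 1"
      using exponent[OF that(2)] that(1) by (simp add: hom_one' n_def)
    finally show ?thesis
      using root_of_unity_eq_power[OF n] unfolding \<zeta>_def by metis
  qed
  \<comment> \<open>A discrete logarithm of \<open>\<chi> x\<close> to the base
    \<open>\<zeta>\<close>, unique only modulo \<open>n\<close>. The ambiguity is harmless because
    \<open>x [^] n\<close> is trivial for all \<open>x\<close>; this is where a generator
    \<open>g\<close> of maximal order pays off.\<close>
  define i where "i x = (SOME k. \<chi> x = \<zeta> ^ k)" for x
  have i: "\<chi> x = \<zeta> ^ i x" if "x \<in> carrier G" for x
    unfolding i_def using root[OF \<chi>(1) that] by (rule someI_ex)
  have \<zeta>_1: "\<zeta> ^ k = 1 \<longleftrightarrow> n dvd k" for k
    unfolding \<zeta>_def by (rule cis_power_eq_1_iff[OF n])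
  have pow_cong: "x [^] a = x [^] b" if "\<zeta> ^ a = \<zeta> ^ b" "x \<in> carrier G" for a b and x
  proof -
    have *: "x [^] a = x [^] b" if "\<zeta> ^ a = \<zeta> ^ b" "a \<le> b" "x \<in> carrier G" for a b and x
    proof -
      have "\<zeta> ^ a * \<zeta> ^ (b - a) = \<zeta> ^ b"
        using that(2) by (simp flip: power_add)
      then have "\<zeta> ^ a * \<zeta> ^ (b - a) = \<zeta> ^ a * 1"
        using that(1) by simp
      then have "\<zeta> ^ (b - a) = 1"
        by (simp add: \<zeta>_def)
      then have "n dvd b - a"
        by (simp only: \<zeta>_1)
      then obtain q where q: "b - a = n * q" by blast
      then have "x [^] b = x [^] a \<otimes> (x [^] n) [^] q"
        using that by (simp add: nat_pow_pow nat_pow_mult flip: q)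
      then show ?thesis
        using exponent[OF that(3)] that(3) by (simp add: n_def)
    qed
    show ?thesis
      using *[OF that(1) _ that(2)] *[OF that(1)[symmetric] _ that(2)] by (metis nat_le_linear)
  qed
  define H where "H = {x \<in> carrier G. \<chi> x = 1}"
  have H: "subgroup H G"
  proof
    show "inv x \<in> H" if "x \<in> H" for x
    proof -
      have "\<chi> x * \<chi> (inv x) = 1"
        using that hom_mult'[OF \<chi>(1), of x "inv x"] hom_one'[OF \<chi>(1)] by (simp add: H_def)
      then show ?thesis using that by (simp add: H_def)
    qed
  qed (auto simp: H_def hom_mult'[OF \<chi>(1)] hom_one'[OF \<chi>(1)])
  \<comment> \<open>The component of \<open>x\<close> in the complement \<open>H\<close>, the other
    component being \<open>g [^] i x\<close>.\<close>
  define h where "h x = x \<otimes> inv (g [^] i x)" for x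
  have h_closed: "h x \<in> carrier G" if "x \<in> carrier G" for x
    using that g by (simp add: h_def)
  have decomp: "g [^] i x \<otimes> h x = x" if "x \<in> carrier G" for x
    using that g by (simp add: h_def m_lcomm)
  have h_H: "h x \<in> H" if x: "x \<in> carrier G" for x
  proof -
    have "\<chi> (g [^] i x) * \<chi> (h x) = \<chi> x"
      using x g h_closed[OF x] hom_mult'[OF \<chi>(1), of "g [^] i x" "h x"] by (simp add: decomp)
    then have "\<zeta> ^ i x * \<chi> (h x) = \<zeta> ^ i x"
      using hom_pow'[OF \<chi>(1) g] i[OF x] by (simp add: \<chi>g)
    then show ?thesis
      using h_closed[OF x] by (simp add: H_def \<zeta>_def)
  qed
  have h_eq: "h (g [^] k \<otimes> a) = a" if "a \<in> H" for a and k :: nat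
  proof -
    have a: "a \<in> carrier G" "\<chi> a = 1" using that by (auto simp: H_def)
    have "\<zeta> ^ i (g [^] k \<otimes> a) = \<zeta> ^ k"
      using a g i[of "g [^] k \<otimes> a"] by (simp add: hom_mult'[OF \<chi>(1)] hom_pow'[OF \<chi>(1)] \<chi>g)
    then have "g [^] i (g [^] k \<otimes> a) = g [^] k"
      using g by (rule pow_cong)
    then have "h (g [^] k \<otimes> a) = (g [^] k \<otimes> a) \<otimes> inv (g [^] k)"
      by (simp add: h_def)
    also have "\<dots> = a"
      using a g by (simp add: m_comm[of "g [^] k" a] m_assoc)
    finally show ?thesis .
  qed
  have h_mult: "h (x \<otimes> y) = h x \<otimes> h y" if "x \<in> carrier G" "y \<in> carrier G" for x y
  proof -
    have "x \<otimes> y = (g [^] i x \<otimes> h x) \<otimes> (g [^] i y \<otimes> h y)"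
      using that by (simp add: decomp)
    also have "\<dots> = g [^] (i x + i y) \<otimes> (h x \<otimes> h y)"
      using that g h_closed by (simp add: m_ac flip: nat_pow_mult)
    finally show ?thesis
      using h_eq[of "h x \<otimes> h y"] subgroup.m_closed[OF H] h_H that by simp
  qed
  have card: "card H < card (carrier G)"
  proof (rule psubset_card_mono[OF fin])
    \<comment> \<open>Nontriviality of \<open>G\<close> enters here: \<open>g\<close> in the kernel
      would force \<open>n = 1\<close>, hence exponent 1. Only a proper subgroup allows the
      induction hypothesis to be applied.\<close>
    have "g \<notin> H"
    proof
      assume "g \<in> H"
      then have "n = 1"
        using \<zeta>_1[of 1] by (simp add: H_def \<chi>g)
      then have "x = \<one>" if "x \<in> carrier G" for x
        using exponent[OF that] that by (simp add: n_def)
      then show False using nontriv by auto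
    qed
    then show "H \<subset> carrier G" using g by (auto simp: H_def)
  qed
  obtain \<gamma> where "perfect_pairing (G\<lparr>carrier := H\<rparr>) \<gamma>"
    using IH[OF H card] by blast
  then have \<gamma>: "\<And>x. x \<in> H \<Longrightarrow> \<gamma> x \<in> hom (G\<lparr>carrier := H\<rparr>) complex_units"
    "\<And>x y. x \<in> H \<Longrightarrow> y \<in> H \<Longrightarrow> \<gamma> x y = \<gamma> y x"
    "\<And>x. x \<in> H \<Longrightarrow> (\<And>y. y \<in> H \<Longrightarrow> \<gamma> x y = 1) \<Longrightarrow> x = \<one>"
    "\<And>\<psi>. \<psi> \<in> hom (G\<lparr>carrier := H\<rparr>) complex_units \<Longrightarrow> \<exists>x\<in>H. \<forall>y\<in>H. \<psi> y = \<gamma> x y"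
    by (auto simp: perfect_pairing_def)
  have \<gamma>_nz: "\<gamma> x y \<noteq> 0" if "x \<in> H" "y \<in> H" for x y
    using hom_in_carrier[OF \<gamma>(1)[OF that(1)], of y] that by simp
  have \<gamma>_mult: "\<gamma> x (y \<otimes> z) = \<gamma> x y * \<gamma> x z" if "x \<in> H" "y \<in> H" "z \<in> H" for x y z
    using hom_mult[OF \<gamma>(1)[OF that(1)], of y z] that by simp
  have \<gamma>_one: "\<gamma> x \<one> = 1" if "x \<in> H" for x
    using \<gamma>_mult[of x \<one> \<one>] \<gamma>_nz[of x \<one>] that subgroup.one_closed[OF H] by simp
  \<comment> \<open>The orthogonal sum of the standard pairing of a cyclic group, \<open>g\<close>
    with itself giving \<open>\<zeta>\<close>, and the pairing \<open>\<gamma>\<close> on the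
    complement.\<close>
  define \<beta> where "\<beta> x y = \<zeta> ^ (i x * i y) * \<gamma> (h x) (h y)" for x y
  have "perfect_pairing G \<beta>"
    unfolding perfect_pairing_def
  proof (intro conjI ballI impI)
    fix x assume x: "x \<in> carrier G"
    show "\<beta> x \<in> hom G complex_units"
    proof (rule homI)
      show "\<beta> x y \<in> carrier complex_units" if "y \<in> carrier G" for y
        using \<gamma>_nz h_H x that by (simp add: \<beta>_def \<zeta>_def)
      fix y z assume yz: "y \<in> carrier G" "z \<in> carrier G"
      have "\<zeta> ^ i (y \<otimes> z) = \<zeta> ^ i y * \<zeta> ^ i z"
        using yz hom_mult'[OF \<chi>(1) yz] by (simp add: i)
      then have "(\<zeta> ^ i (y \<otimes> z)) ^ i x = (\<zeta> ^ i y) ^ i x * (\<zeta> ^ i z) ^ i x"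
        by (simp only: power_mult_distrib)
      then have "\<zeta> ^ (i x * i (y \<otimes> z)) = \<zeta> ^ (i x * i y) * \<zeta> ^ (i x * i z)"
        by (simp only: power_mult[symmetric] mult.commute[of "i x"])
      then show "\<beta> x (y \<otimes> z) = \<beta> x y \<otimes>\<^bsub>complex_units\<^esub> \<beta> x z"
        using x yz h_H by (simp add: \<beta>_def h_mult \<gamma>_mult)
    qed
    show "\<beta> x y = \<beta> y x" if "y \<in> carrier G" for y
      using \<gamma>(2) h_H x that by (simp add: \<beta>_def mult.commute)
    assume triv: "\<forall>y\<in>carrier G. \<beta> x y = 1"
    \<comment> \<open>Pairing with \<open>g\<close> sees only the cyclic component and returns
      \<open>\<chi> x\<close>, so triviality places \<open>x\<close> in \<open>H\<close>. Pairing
      with elements of \<open>H\<close> then reduces to \<open>\<gamma>\<close>.\<close>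
    have "h g = \<one>"
      using h_eq[of \<one> 1] subgroup.one_closed[OF H] g by simp
    moreover have "\<zeta> ^ (i x * i g) = \<chi> x"
      using i[OF g] i[OF x] by (simp add: \<chi>g mult.commute[of "i x"] power_mult flip: i[OF g])
    ultimately have "\<chi> x = 1"
      using bspec[OF triv g] \<gamma>_one[OF h_H[OF x]] by (simp add: \<beta>_def)
    then have xH: "x \<in> H" using x by (simp add: H_def)
    show "x = \<one>"
    proof (rule \<gamma>(3)[OF xH])
      fix y assume y: "y \<in> H"
      have h_id: "h z = z" if "z \<in> H" for z
        using h_eq[OF that, of 0] that by (simp add: H_def)
      have "\<zeta> ^ i x = 1"
        using i[OF x] xH by (simp add: H_def)
      then have "\<zeta> ^ (i x * i y) = 1"
        by (simp only: power_mult power_one)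
      moreover have "y \<in> carrier G"
        using y by (simp add: H_def)
      ultimately show "\<gamma> x y = 1"
        using bspec[OF triv, of y] by (simp add: \<beta>_def h_id xH y)
    qed
  next
    fix \<psi> assume \<psi>: "\<psi> \<in> hom G complex_units"
    have "\<psi> \<in> hom (G\<lparr>carrier := H\<rparr>) complex_units"
      using \<psi> by (auto simp: hom_def H_def)
    then obtain a where a: "a \<in> H" "\<And>y. y \<in> H \<Longrightarrow> \<psi> y = \<gamma> a y"
      using \<gamma>(4) by blast
    obtain j where j: "\<psi> g = \<zeta> ^ j" using root[OF \<psi> g] by blast
    have ac: "a \<in> carrier G" "\<chi> a = 1" using a(1) by (auto simp: H_def)
    \<comment> \<open>The two components of \<open>\<psi>\<close> are represented separately: the
      exponent \<open>j\<close> reproduces \<open>\<psi> g\<close>, and \<open>a\<close> reproduces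
      the restriction to \<open>H\<close>.\<close>
    define x where "x = g [^] j \<otimes> a"
    have x: "x \<in> carrier G" using g ac by (simp add: x_def)
    have ix: "\<zeta> ^ i x = \<zeta> ^ j"
      using ac g i[OF x] by (simp add: x_def hom_mult'[OF \<chi>(1)] hom_pow'[OF \<chi>(1)] \<chi>g)
    have "\<psi> y = \<beta> x y" if y: "y \<in> carrier G" for y
    proof -
      have "\<psi> y = \<psi> (g [^] i y \<otimes> h y)"
        using y by (simp add: decomp)
      also have "\<dots> = (\<zeta> ^ j) ^ i y * \<gamma> a (h y)"
        using y g h_closed h_H a(2) by (simp add: hom_mult'[OF \<psi>] hom_pow'[OF \<psi>] j)
      also have "\<dots> = \<beta> x y"
        using h_eq[OF a(1), of j] by (simp add: \<beta>_def power_mult ix) (simp add: x_def)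
      finally show ?thesis .
    qed
    then show "\<exists>x\<in>carrier G. \<forall>y\<in>carrier G. \<psi> y = \<beta> x y"
      using x by blast
  qed
  then show ?thesis by blast
qed

lemma ex_perfect_pairing:
  assumes "comm_group G" "finite (carrier G)"
  shows "\<exists>\<beta>. perfect_pairing G \<beta>"
  using assms
proof (induction "card (carrier G)" arbitrary: G rule: less_induct)
  case (less G)
  then interpret comm_group G by simp
  show ?case
  proof (rule perfect_pairing_step)
    fix H assume H: "subgroup H G" "card H < card (carrier G)"
    have "finite H"
      using less.prems(2) subgroup.subset[OF H(1)] by (rule rev_finite_subset)
    then show "\<exists>\<gamma>. perfect_pairing (G\<lparr>carrier := H\<rparr>) \<gamma>"
      using H(2) subgroup_is_comm_group[OF H(1)] by (intro less.hyps) auto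
  qed fact
qed

lemma perfect_pairingD:
  assumes "perfect_pairing G \<beta>"
  shows "\<And>x. x \<in> carrier G \<Longrightarrow> \<beta> x \<in> hom G complex_units"
    and "\<And>x y. x \<in> carrier G \<Longrightarrow> y \<in> carrier G \<Longrightarrow> \<beta> x y = \<beta> y x"
    and "\<And>x. x \<in> carrier G \<Longrightarrow> (\<And>y. y \<in> carrier G \<Longrightarrow> \<beta> x y = 1) \<Longrightarrow> x = \<one>\<^bsub>G\<^esub>"
    and "\<And>\<psi>. \<psi> \<in> hom G complex_units \<Longrightarrow> \<exists>x\<in>carrier G. \<forall>y\<in>carrier G. \<psi> y = \<beta> x y"
  using assms unfolding perfect_pairing_def by blast+

lemma (in comm_group) perfect_pairing_mult:
  assumes \<beta>: "perfect_pairing G \<beta>" and x: "x \<in> carrier G" "y \<in> carrier G" "k \<in> carrier G"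
  shows "\<beta> (x \<otimes> y) k = \<beta> x k * \<beta> y k"
  using hom_mult[OF perfect_pairingD(1)[OF \<beta> x(3)] x(1,2)] perfect_pairingD(2)[OF \<beta>] x by simp

lemma (in comm_group) perfect_pairing_one:
  assumes \<beta>: "perfect_pairing G \<beta>" and k: "k \<in> carrier G"
  shows "\<beta> \<one> k = 1"
  using hom_one[OF perfect_pairingD(1)[OF \<beta> k] group_axioms complex_units.group_axioms]
    perfect_pairingD(2)[OF \<beta> k one_closed] by simp

text \<open>This is the device that carries identities between complex factor sets back to
  identities in the abstract group: it suffices to test both sides against every character.\<close>

lemma (in comm_group) perfect_pairing_eqI:
  assumes \<beta>: "perfect_pairing G \<beta>" and x: "x \<in> carrier G" "y \<in> carrier G"
    and eq: "\<And>k. k \<in> carrier G \<Longrightarrow> \<beta> x k = \<beta> y k"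
  shows "x = y"
proof -
  have "\<beta> (x \<otimes> inv y) k = 1" if "k \<in> carrier G" for k
    using that x perfect_pairing_mult[OF \<beta> x(1) inv_closed[OF x(2)] that]
      perfect_pairing_mult[OF \<beta> x(2) inv_closed[OF x(2)] that] perfect_pairing_one[OF \<beta> that]
    by (simp add: eq)
  then have "x \<otimes> inv y = \<one>"
    using x by (intro perfect_pairingD(3)[OF \<beta>]) simp_all
  then show ?thesis
    using inv_unique' inv_equality inv_inv x by (metis inv_closed)
qed

section \<open>The Schur multiplier\<close>

context skew_brace
begin

lemmas add_closed [simp] = add.m_closed[simplified]
lemmas zero_mem [simp] = add.one_closed[simplified]
lemmas add_assoc = add.m_assoc[simplified]
lemmas zero_add [simp] = add.l_one[simplified]
lemmas add_zero [simp] = add.r_one[simplified]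
lemmas neg_closed [simp] = add.inv_closed[folded a_inv_def, simplified]
lemmas neg_add [simp] = add.l_inv[folded a_inv_def, simplified]
lemmas add_neg [simp] = add.r_inv[folded a_inv_def, simplified]

lemma circ_zero [simp]: "x \<in> carrier A \<Longrightarrow> x \<otimes> \<zero> = x"
  using circ.r_one one_eq_zero by simp

lemma zero_circ [simp]: "x \<in> carrier A \<Longrightarrow> \<zero> \<otimes> x = x"
  using circ.l_one one_eq_zero by simp

section \<open>Complex factor sets as an abelian group\<close>

text \<open>With the inverses cleared, each condition equates two monomials, a shape visibly
  preserved by pointwise products and inverses.\<close>

lemma factor_sets_complex_iff:
  "(\<alpha>, \<mu>) \<in> factor_sets A complex_units \<longleftrightarrow>
    \<alpha> \<in> carrier A \<times> carrier A \<rightarrow>\<^sub>E - {0} \<and> \<mu> \<in> carrier A \<times> carrier A \<rightarrow>\<^sub>E - {0} \<and>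
    (\<forall>x \<in> carrier A. \<alpha> (\<zero>, x) = 1 \<and> \<alpha> (x, \<zero>) = 1 \<and> \<mu> (\<zero>, x) = 1 \<and> \<mu> (x, \<zero>) = 1) \<and>
    (\<forall>x \<in> carrier A. \<forall>y \<in> carrier A. \<forall>z \<in> carrier A.
      \<alpha> (y, z) * \<alpha> (x, y \<oplus> z) = \<alpha> (x \<oplus> y, z) * \<alpha> (x, y) \<and>
      \<mu> (y, z) * \<mu> (x, y \<otimes> z) = \<mu> (x \<otimes> y, z) * \<mu> (x, y) \<and>
      \<alpha> (y, z) * \<mu> (x, y \<oplus> z) * \<alpha> (\<ominus> x, x) =
        \<mu> (x, z) * \<alpha> (x \<otimes> y, \<ominus> x) * \<alpha> ((x \<otimes> y) \<ominus> x, x \<otimes> z) * \<mu> (x, y))"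
proof -
  have eq: "f (y, z) * inverse (f (u, z)) * f (x, v) * inverse (f (x, y)) = 1 \<longleftrightarrow>
      f (y, z) * f (x, v) = f (u, z) * f (x, y)"
    if "f \<in> carrier A \<times> carrier A \<rightarrow>\<^sub>E - {0}" "x \<in> carrier A" "y \<in> carrier A" "z \<in> carrier A"
      "u \<in> carrier A" "v \<in> carrier A" for f :: "_ \<Rightarrow> complex" and x y z u v
    using PiE_mem[OF that(1), of "(y, z)"] PiE_mem[OF that(1), of "(u, z)"]
      PiE_mem[OF that(1), of "(x, v)"] PiE_mem[OF that(1), of "(x, y)"] that(2-)
    by (simp add: field_simps)
  have nz: "f (x, y) \<noteq> 0" if "f \<in> carrier A \<times> carrier A \<rightarrow>\<^sub>E - {0}" "x \<in> carrier A" "y \<in> carrier A"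
    for f :: "_ \<Rightarrow> complex" and x y
    using PiE_mem[OF that(1), of "(x, y)"] that(2-) by simp
  show ?thesis
    unfolding factor_sets_def mem_Collect_eq prod.case complex_units_simps
    by (intro conj_cong ball_cong refl) (simp_all add: eq nz)
qed

abbreviation "ZC \<equiv> Z2b A complex_units"
abbreviation "BC \<equiv> B2b A complex_units"

lemma ZC_simps [simp]:
  "carrier ZC = factor_sets A complex_units"
  "c \<otimes>\<^bsub>ZC\<^esub> c' = ((\<lambda>i\<in>carrier A \<times> carrier A. fst c i * fst c' i), (\<lambda>i\<in>carrier A \<times> carrier A. snd c i * snd c' i))"
  "\<one>\<^bsub>ZC\<^esub> = ((\<lambda>i\<in>carrier A \<times> carrier A. 1), (\<lambda>i\<in>carrier A \<times> carrier A. 1))"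
  by (simp_all add: Z2b_def mult_DirProd')

lemma factor_setsD:
  assumes "c \<in> factor_sets A complex_units"
  shows factor_set_PiE: "fst c \<in> carrier A \<times> carrier A \<rightarrow>\<^sub>E - {0}" "snd c \<in> carrier A \<times> carrier A \<rightarrow>\<^sub>E - {0}"
    and factor_set_nz: "\<And>x y. x \<in> carrier A \<Longrightarrow> y \<in> carrier A \<Longrightarrow> fst c (x, y) \<noteq> 0"
      "\<And>x y. x \<in> carrier A \<Longrightarrow> y \<in> carrier A \<Longrightarrow> snd c (x, y) \<noteq> 0"
    and factor_set_normalised: "\<And>x. x \<in> carrier A \<Longrightarrow> fst c (\<zero>, x) = 1" "\<And>x. x \<in> carrier A \<Longrightarrow> fst c (x, \<zero>) = 1"
      "\<And>x. x \<in> carrier A \<Longrightarrow> snd c (\<zero>, x) = 1" "\<And>x. x \<in> carrier A \<Longrightarrow> snd c (x, \<zero>) = 1"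
    and factor_set_cocycle: "\<And>x y z. x \<in> carrier A \<Longrightarrow> y \<in> carrier A \<Longrightarrow> z \<in> carrier A \<Longrightarrow>
        fst c (y, z) * fst c (x, y \<oplus> z) = fst c (x \<oplus> y, z) * fst c (x, y)"
      "\<And>x y z. x \<in> carrier A \<Longrightarrow> y \<in> carrier A \<Longrightarrow> z \<in> carrier A \<Longrightarrow>
        snd c (y, z) * snd c (x, y \<otimes> z) = snd c (x \<otimes> y, z) * snd c (x, y)"
      "\<And>x y z. x \<in> carrier A \<Longrightarrow> y \<in> carrier A \<Longrightarrow> z \<in> carrier A \<Longrightarrow>
        fst c (y, z) * snd c (x, y \<oplus> z) * fst c (\<ominus> x, x) =
        snd c (x, z) * fst c (x \<otimes> y, \<ominus> x) * fst c ((x \<otimes> y) \<ominus> x, x \<otimes> z) * snd c (x, y)"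
proof -
  have c: "(fst c, snd c) \<in> factor_sets A complex_units" using assms by simp
  show PiE: "fst c \<in> carrier A \<times> carrier A \<rightarrow>\<^sub>E - {0}" "snd c \<in> carrier A \<times> carrier A \<rightarrow>\<^sub>E - {0}"
    using c[unfolded factor_sets_complex_iff] by blast+
  show "fst c (x, y) \<noteq> 0" "snd c (x, y) \<noteq> 0" if "x \<in> carrier A" "y \<in> carrier A" for x y
    using PiE_mem[OF PiE(1), of "(x, y)"] PiE_mem[OF PiE(2), of "(x, y)"] that by auto
qed (use assms factor_sets_complex_iff[of "fst c" "snd c", unfolded prod.collapse] in blast)+

lemma neg_sub [simp]: "\<lbrakk>x \<in> carrier A; y \<in> carrier A\<rbrakk> \<Longrightarrow> x \<ominus> y \<in> carrier A"
  by (simp add: a_minus_def)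

lemma comm_group_ZC: "comm_group ZC"
proof -
  let ?I = "carrier A \<times> carrier A"
  show ?thesis
  proof (rule comm_groupI)
    fix c c' assume "c \<in> carrier ZC" "c' \<in> carrier ZC"
    then have c: "c \<in> factor_sets A complex_units" "c' \<in> factor_sets A complex_units" by simp_all
    have mult: "x * x' * (y * y') = u * u' * (v * v')" if "x * y = u * v" "x' * y' = u' * v'"
      for x x' y y' u u' v v' :: complex
      using arg_cong2[OF that, of "(*)"] by (simp add: mult_ac)
    have mult3: "x * x' * (y * y') * (z * z') = u * u' * (v * v') * (w * w') * (r * r')"
      if "x * y * z = u * v * w * r" "x' * y' * z' = u' * v' * w' * r'"
      for x x' y y' z z' u u' v v' w w' r r' :: complex
      using arg_cong2[OF that, of "(*)"] by (simp add: mult_ac)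
    show "c \<otimes>\<^bsub>ZC\<^esub> c' \<in> carrier ZC"
      unfolding ZC_simps factor_sets_complex_iff
      by (intro conjI ballI; (simp add: factor_set_nz[OF c(1)] factor_set_nz[OF c(2)]
          factor_set_normalised[OF c(1)] factor_set_normalised[OF c(2)];
          (rule mult mult3; rule factor_set_cocycle[OF c(1)] factor_set_cocycle[OF c(2)]; assumption)?)?)
        (auto simp: factor_set_nz[OF c(1)] factor_set_nz[OF c(2)])
  next
    show "\<one>\<^bsub>ZC\<^esub> \<in> carrier ZC"
      by (simp add: factor_sets_complex_iff)
  next
    fix c c' c'' assume "c \<in> carrier ZC" "c' \<in> carrier ZC" "c'' \<in> carrier ZC"
    show "c \<otimes>\<^bsub>ZC\<^esub> c' \<otimes>\<^bsub>ZC\<^esub> c'' = c \<otimes>\<^bsub>ZC\<^esub> (c' \<otimes>\<^bsub>ZC\<^esub> c'')"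
      by (auto simp: mult_ac)
    show "c \<otimes>\<^bsub>ZC\<^esub> c' = c' \<otimes>\<^bsub>ZC\<^esub> c"
      by (auto simp: mult_ac)
  next
    fix c assume "c \<in> carrier ZC"
    then have c: "c \<in> factor_sets A complex_units" by simp
    show "\<one>\<^bsub>ZC\<^esub> \<otimes>\<^bsub>ZC\<^esub> c = c"
      using factor_set_PiE[OF c] by (auto simp: prod_eq_iff PiE_def extensional_def fun_eq_iff)
    have inv2: "inverse x * inverse y = inverse u * inverse v" if "x * y = u * v"
      for x y u v :: complex
      using arg_cong[OF that, of inverse] by (simp add: mult_ac)
    have inv3: "inverse x * inverse y * inverse z = inverse u * inverse v * inverse w * inverse r"
      if "x * y * z = u * v * w * r" for x y z u v w r :: complex
      using arg_cong[OF that, of inverse] by (simp add: mult_ac)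
    let ?c = "((\<lambda>i\<in>?I. inverse (fst c i)), (\<lambda>i\<in>?I. inverse (snd c i)))"
    have "?c \<in> carrier ZC"
      unfolding ZC_simps factor_sets_complex_iff
      by (intro conjI ballI; (simp add: factor_set_nz[OF c] factor_set_normalised[OF c];
          (rule inv2 inv3; rule factor_set_cocycle[OF c]; assumption)?)?)
        (auto simp: factor_set_nz[OF c])
    moreover have "?c \<otimes>\<^bsub>ZC\<^esub> c = \<one>\<^bsub>ZC\<^esub>"
      by (auto simp: factor_set_nz[OF c] fun_eq_iff)
    ultimately show "\<exists>c'\<in>carrier ZC. c' \<otimes>\<^bsub>ZC\<^esub> c = \<one>\<^bsub>ZC\<^esub>"
      by blast
  qed
qed

sublocale ZC: comm_group ZC
  by (rule comm_group_ZC)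

lemma pow_ZC:
  "c \<in> factor_sets A complex_units \<Longrightarrow> c [^]\<^bsub>ZC\<^esub> (n::nat) =
    ((\<lambda>i\<in>carrier A \<times> carrier A. fst c i ^ n), (\<lambda>i\<in>carrier A \<times> carrier A. snd c i ^ n))"
  by (induction n) (auto simp: mult.commute)

section \<open>Coboundaries: subgroup and divisibility\<close>

lemma BC_eq: "BC = {((\<lambda>(x, y)\<in>carrier A \<times> carrier A. h y * h x / h (x \<oplus> y)),
    (\<lambda>(x, y)\<in>carrier A \<times> carrier A. h y * h x / h (x \<otimes> y))) | h. h \<in> carrier A \<rightarrow> - {0} \<and> h \<zero> = 1}"
proof -
  have "d_add A complex_units h = (\<lambda>(x, y)\<in>carrier A \<times> carrier A. h y * h x / h (x \<oplus> y))"
    "d_circ A complex_units h = (\<lambda>(x, y)\<in>carrier A \<times> carrier A. h y * h x / h (x \<otimes> y))"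
    if "h \<in> carrier A \<rightarrow> - {0}" for h
    using Pi_mem[OF that]
    by (auto simp: d_add_def d_circ_def fun_eq_iff restrict_def field_simps)
  then show ?thesis
    unfolding B2b_def by (intro Collect_cong ex_cong1) auto
qed

lemma B2b_subgroup: "subgroup BC ZC"
proof
  have nz: "h x \<noteq> 0" if "h \<in> carrier A \<rightarrow> - {0}" "x \<in> carrier A" for h :: "_ \<Rightarrow> complex" and x
    using Pi_mem[OF that] by simp
  show "BC \<subseteq> carrier ZC"
  proof
    fix c assume "c \<in> BC"
    then obtain h where h: "h \<in> carrier A \<rightarrow> - {0}" "h \<zero> = 1" and
      c: "c = ((\<lambda>(x, y)\<in>carrier A \<times> carrier A. h y * h x / h (x \<oplus> y)),
        (\<lambda>(x, y)\<in>carrier A \<times> carrier A. h y * h x / h (x \<otimes> y)))"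
      by (auto simp: BC_eq)
    \<comment> \<open>Read \<open>x\<close>, \<open>y\<close>, \<open>z\<close> as values of
      \<open>h\<close>, \<open>b\<close> and \<open>c\<close> as the values at the two partial
      products, and \<open>d\<close> as the value at the triple product. Associativity is what makes
      \<open>d\<close> common to both sides.\<close>
    have coc: "(z * y / b) * (b * x / d) = (z * c / d) * (y * x / c)" if "b \<noteq> 0" "c \<noteq> 0"
      for b c d x y z :: complex
      using that by (simp add: field_simps)
    \<comment> \<open>Here \<open>m\<close> stands for \<open>h (\<ominus> x)\<close>,
      \<open>b\<close> for \<open>h (y \<oplus> z)\<close>, \<open>e\<close> and \<open>p\<close>
      for \<open>h\<close> at \<open>x \<otimes> z\<close> and \<open>x \<otimes> y\<close>, and
      \<open>q\<close> for \<open>h\<close> at \<open>x \<otimes> y \<ominus> x\<close>. The common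
      denominator \<open>d\<close> is \<open>h (x \<otimes> (y \<oplus> z))\<close>, which brace
      distributivity also produces on the right; the denominator 1 is
      \<open>h \<zero>\<close>.\<close>
    have compat: "(z * y / b) * (b * x / d) * (x * m / 1) = (z * x / e) * (m * p / q) * (e * q / d) * (y * x / p)"
      if "b \<noteq> 0" "e \<noteq> 0" "p \<noteq> 0" "q \<noteq> 0" for b d e m p q x y z :: complex
      using that by (simp add: field_simps)
    show "c \<in> carrier ZC"
      unfolding ZC_simps c factor_sets_complex_iff
    proof (intro conjI ballI)
      fix x y z assume xyz: "x \<in> carrier A" "y \<in> carrier A" "z \<in> carrier A"
      have "h (y \<oplus> z) \<noteq> 0" "h (x \<otimes> z) \<noteq> 0" "h (x \<otimes> y) \<noteq> 0" "h (x \<otimes> y \<ominus> x) \<noteq> 0"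
        using xyz by (simp_all add: nz[OF h(1)])
      from compat[OF this, where z = "h z" and y = "h y" and x = "h x" and m = "h (\<ominus> x)"
          and d = "h (x \<otimes> (y \<oplus> z))"]
      show "(\<lambda>(x, y)\<in>carrier A \<times> carrier A. h y * h x / h (x \<oplus> y)) (y, z) *
        (\<lambda>(x, y)\<in>carrier A \<times> carrier A. h y * h x / h (x \<otimes> y)) (x, y \<oplus> z) *
        (\<lambda>(x, y)\<in>carrier A \<times> carrier A. h y * h x / h (x \<oplus> y)) (\<ominus> x, x) =
        (\<lambda>(x, y)\<in>carrier A \<times> carrier A. h y * h x / h (x \<otimes> y)) (x, z) *
        (\<lambda>(x, y)\<in>carrier A \<times> carrier A. h y * h x / h (x \<oplus> y)) (x \<otimes> y, \<ominus> x) *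
        (\<lambda>(x, y)\<in>carrier A \<times> carrier A. h y * h x / h (x \<oplus> y)) (x \<otimes> y \<ominus> x, x \<otimes> z) *
        (\<lambda>(x, y)\<in>carrier A \<times> carrier A. h y * h x / h (x \<otimes> y)) (x, y)"
        using xyz by (simp add: h(2) brace_distrib flip: a_minus_def)
      show "(\<lambda>(x, y)\<in>carrier A \<times> carrier A. h y * h x / h (x \<oplus> y)) (y, z) *
        (\<lambda>(x, y)\<in>carrier A \<times> carrier A. h y * h x / h (x \<oplus> y)) (x, y \<oplus> z) =
        (\<lambda>(x, y)\<in>carrier A \<times> carrier A. h y * h x / h (x \<oplus> y)) (x \<oplus> y, z) *
        (\<lambda>(x, y)\<in>carrier A \<times> carrier A. h y * h x / h (x \<oplus> y)) (x, y)"
        using coc[OF nz[OF h(1), of "y \<oplus> z"] nz[OF h(1), of "x \<oplus> y"]] xyz by (simp add: add_assoc)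
      show "(\<lambda>(x, y)\<in>carrier A \<times> carrier A. h y * h x / h (x \<otimes> y)) (y, z) *
        (\<lambda>(x, y)\<in>carrier A \<times> carrier A. h y * h x / h (x \<otimes> y)) (x, y \<otimes> z) =
        (\<lambda>(x, y)\<in>carrier A \<times> carrier A. h y * h x / h (x \<otimes> y)) (x \<otimes> y, z) *
        (\<lambda>(x, y)\<in>carrier A \<times> carrier A. h y * h x / h (x \<otimes> y)) (x, y)"
        using coc[OF nz[OF h(1), of "y \<otimes> z"] nz[OF h(1), of "x \<otimes> y"]] xyz by (simp add: circ.m_assoc)
    qed (auto simp: nz[OF h(1)] h(2))
  qed
  show "c \<otimes>\<^bsub>ZC\<^esub> c' \<in> BC" if cc: "c \<in> BC" "c' \<in> BC" for c c'
  proof -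
    from cc obtain h h' where h: "h \<in> carrier A \<rightarrow> - {0}" "h \<zero> = 1" "h' \<in> carrier A \<rightarrow> - {0}" "h' \<zero> = 1" and
      c: "c = ((\<lambda>(x, y)\<in>carrier A \<times> carrier A. h y * h x / h (x \<oplus> y)),
        (\<lambda>(x, y)\<in>carrier A \<times> carrier A. h y * h x / h (x \<otimes> y)))"
        "c' = ((\<lambda>(x, y)\<in>carrier A \<times> carrier A. h' y * h' x / h' (x \<oplus> y)),
        (\<lambda>(x, y)\<in>carrier A \<times> carrier A. h' y * h' x / h' (x \<otimes> y)))"
      by (auto simp: BC_eq)
    show ?thesis
      unfolding BC_eq using h
      by (intro CollectI exI[of _ "\<lambda>x. h x * h' x"]) (auto simp: c fun_eq_iff mult_ac)
  qed
  show "\<one>\<^bsub>ZC\<^esub> \<in> BC"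
    unfolding BC_eq by (intro CollectI exI[of _ "\<lambda>x. 1"]) auto
  show "inv\<^bsub>ZC\<^esub> c \<in> BC" if cc: "c \<in> BC" for c
  proof -
    from cc obtain h where h: "h \<in> carrier A \<rightarrow> - {0}" "h \<zero> = 1" and
      c: "c = ((\<lambda>(x, y)\<in>carrier A \<times> carrier A. h y * h x / h (x \<oplus> y)),
        (\<lambda>(x, y)\<in>carrier A \<times> carrier A. h y * h x / h (x \<otimes> y)))"
      by (auto simp: BC_eq)
    define c' where "c' = ((\<lambda>(x, y)\<in>carrier A \<times> carrier A. inverse (h y) * inverse (h x) / inverse (h (x \<oplus> y))),
        (\<lambda>(x, y)\<in>carrier A \<times> carrier A. inverse (h y) * inverse (h x) / inverse (h (x \<otimes> y))))"
    have c': "c' \<in> BC"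
      unfolding BC_eq c'_def using h by (intro CollectI exI[of _ "\<lambda>x. inverse (h x)"]) auto
    have "c' \<otimes>\<^bsub>ZC\<^esub> c = \<one>\<^bsub>ZC\<^esub>"
      by (auto simp: c c'_def fun_eq_iff nz[OF h(1)] field_simps)
    then have "inv\<^bsub>ZC\<^esub> c = c'"
      using \<open>BC \<subseteq> carrier ZC\<close> cc c' by (intro ZC.inv_equality) auto
    then show ?thesis using c' by simp
  qed
qed

lemma B2b_divisible:
  assumes "b \<in> BC" "n > 0"
  shows "\<exists>c\<in>BC. c [^]\<^bsub>ZC\<^esub> (n::nat) = b"
proof -
  from assms(1) obtain h where h: "h \<in> carrier A \<rightarrow> - {0}" "h \<zero> = 1" and
    b: "b = ((\<lambda>(x, y)\<in>carrier A \<times> carrier A. h y * h x / h (x \<oplus> y)),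
      (\<lambda>(x, y)\<in>carrier A \<times> carrier A. h y * h x / h (x \<otimes> y)))"
    by (auto simp: BC_eq)
  have "\<exists>e. e \<noteq> 0 \<and> e ^ n = h x" if "x \<in> carrier A" for x
    using complex_units_divisible[of "h x" n] Pi_mem[OF h(1) that] assms(2) by auto
  then obtain k where k: "\<And>x. x \<in> carrier A \<Longrightarrow> k x \<noteq> 0 \<and> k x ^ n = h x"
    by metis
  \<comment> \<open>The root chosen at \<open>\<zero>\<close> may be any \<open>n\<close>-th root of
    unity, whereas a coboundary requires a normalised cochain; the value is reset to 1, still a root
    of \<open>h \<zero> = 1\<close>.\<close>
  define k' where "k' = k(\<zero> := 1)"
  have k': "k' \<zero> = 1" "k' \<in> carrier A \<rightarrow> - {0}" "\<And>x. x \<in> carrier A \<Longrightarrow> k' x ^ n = h x"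
    using k h(2) by (auto simp: k'_def)
  define c where "c = ((\<lambda>(x, y)\<in>carrier A \<times> carrier A. k' y * k' x / k' (x \<oplus> y)),
      (\<lambda>(x, y)\<in>carrier A \<times> carrier A. k' y * k' x / k' (x \<otimes> y)))"
  have c: "c \<in> BC"
    unfolding BC_eq c_def using k' by blast
  then have "c \<in> factor_sets A complex_units"
    using subgroup.subset[OF B2b_subgroup] by auto
  then have "c [^]\<^bsub>ZC\<^esub> n = b"
    by (simp add: pow_ZC) (auto simp: c_def b fun_eq_iff power_mult_distrib power_divide k')
  then show ?thesis using c by blast
qed

lemma B2b_I:
  assumes "h \<in> carrier A \<rightarrow> - {0}" "h \<zero> = 1"
  shows "((\<lambda>(x, y)\<in>carrier A \<times> carrier A. h y * h x / h (x \<oplus> y)),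
      (\<lambda>(x, y)\<in>carrier A \<times> carrier A. h y * h x / h (x \<otimes> y))) \<in> BC"
  using assms unfolding BC_eq by blast

text \<open>
  Averaging kills the additive cocycle up to the \<open>n\<close>-th power; what remains is a factor set
  \<open>(1, \<mu>)\<close>, and the compatibility condition makes \<open>\<mu> (x, _)\<close> a character of the additive group.
\<close>

lemma factor_set_pow_in_B2b:
  assumes fin: "finite (carrier A)" and c: "c \<in> factor_sets A complex_units"
  shows "c [^]\<^bsub>ZC\<^esub> (card (carrier A) * card (carrier A)) \<in> BC"
proof -
  define n where "n = card (carrier A)"
  define h where "h w = (\<Prod>v\<in>carrier A. fst c (v, w))" for w
  have h: "h \<in> carrier A \<rightarrow> - {0}" "h \<zero> = 1"
    using fin by (auto simp: h_def factor_set_nz[OF c] factor_set_normalised[OF c])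
  define b where "b = ((\<lambda>(x, y)\<in>carrier A \<times> carrier A. h y * h x / h (x \<oplus> y)),
      (\<lambda>(x, y)\<in>carrier A \<times> carrier A. h y * h x / h (x \<otimes> y)))"
  have b: "b \<in> BC"
    unfolding b_def by (rule B2b_I[OF h])
  have bZ: "b \<in> factor_sets A complex_units"
    using b subgroup.subset[OF B2b_subgroup] by auto
  have cn: "c [^]\<^bsub>ZC\<^esub> n \<in> carrier ZC"
    using c by (intro ZC.nat_pow_closed) simp
  have fst_pow: "fst c (x, y) ^ n = fst b (x, y)" if x: "x \<in> carrier A" and y: "y \<in> carrier A" for x y
  proof -
    \<comment> \<open>The cocycle identity at \<open>w\<close>, \<open>x\<close>, \<open>y\<close>
      is multiplied over all \<open>w\<close>. Translation by \<open>x\<close> permutes the carrier,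
      so the shifted product is again \<open>h y\<close>, and the \<open>n\<close>-th power of the
      additive component becomes the coboundary of \<open>h\<close>.\<close>
    have "fst c (x, y) ^ n * h (x \<oplus> y) = (\<Prod>w\<in>carrier A. fst c (x, y) * fst c (w, x \<oplus> y))"
      by (simp add: h_def prod.distrib n_def)
    also have "\<dots> = (\<Prod>w\<in>carrier A. fst c (w \<oplus> x, y) * fst c (w, x))"
      using x y by (intro prod.cong refl factor_set_cocycle(1)[OF c])
    also have "\<dots> = (\<Prod>w\<in>carrier A. fst c (w \<oplus> x, y)) * h x"
      by (simp add: h_def prod.distrib)
    also have "(\<Prod>w\<in>carrier A. fst c (w \<oplus> x, y)) = h y"
      unfolding h_def
    proof (rule prod.reindex_bij_witness[where i = "\<lambda>w. w \<ominus> x" and j = "\<lambda>w. w \<oplus> x"])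
      fix w assume "w \<in> carrier A"
      then show "w \<oplus> x \<ominus> x = w" "w \<ominus> x \<oplus> x = w"
        using x by (simp_all add: a_minus_def add_assoc)
    qed (use x in auto)
    finally show ?thesis
      using x y Pi_mem[OF h(1), of "x \<oplus> y"] by (simp add: b_def field_simps)
  qed
  define d where "d = c [^]\<^bsub>ZC\<^esub> n \<otimes>\<^bsub>ZC\<^esub> inv\<^bsub>ZC\<^esub> b"
  have dZ: "d \<in> carrier ZC"
    unfolding d_def using cn bZ by (intro ZC.m_closed ZC.inv_closed) simp_all
  then have d: "d \<in> factor_sets A complex_units" by simp
  have db: "d \<otimes>\<^bsub>ZC\<^esub> b = c [^]\<^bsub>ZC\<^esub> n"
    unfolding d_def using cn bZ by (metis ZC.inv_closed ZC.l_inv ZC.m_assoc ZC.r_one ZC_simps(1))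
  have fst_d: "fst d (x, y) = 1" if "x \<in> carrier A" "y \<in> carrier A" for x y
  proof -
    have "fst (d \<otimes>\<^bsub>ZC\<^esub> b) (x, y) = fst (c [^]\<^bsub>ZC\<^esub> n) (x, y)"
      by (simp only: db)
    then have "fst d (x, y) * fst b (x, y) = fst b (x, y)"
      using that by (simp add: pow_ZC[OF c] fst_pow)
    then show ?thesis
      using factor_set_nz(1)[OF bZ that] by simp
  qed
  have snd_d: "snd d (x, y) ^ n = 1" if x: "x \<in> carrier A" and y: "y \<in> carrier A" for x y
  proof -
    have hom: "(\<lambda>y. snd d (x, y)) \<in> hom (add_monoid A) complex_units"
    proof (rule homI)
      fix y z assume "y \<in> carrier (add_monoid A)" "z \<in> carrier (add_monoid A)"
      then show "snd d (x, y \<otimes>\<^bsub>add_monoid A\<^esub> z) = snd d (x, y) \<otimes>\<^bsub>complex_units\<^esub> snd d (x, z)"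
        using factor_set_cocycle(3)[OF d x, of y z] x by (simp add: fst_d mult.commute)
    qed (simp add: factor_set_nz[OF d] x)
    have "snd d (x, y) ^ n = snd d (x, y [^]\<^bsub>add_monoid A\<^esub> n)"
      using hom_nat_pow[OF hom _ add.group_axioms complex_units.group_axioms, of y n] y by simp
    \<comment> \<open>Lagrange's theorem: the additive order of \<open>y\<close> divides
      \<open>n\<close>, so a character value at \<open>y\<close> is an \<open>n\<close>-th root of
      unity.\<close>
    also have "y [^]\<^bsub>add_monoid A\<^esub> n = \<zero>"
      using add.pow_order_eq_1[of y] y fin by (simp add: order_def n_def)
    finally show ?thesis
      using x by (simp add: factor_set_normalised[OF d])
  qed
  have dn: "d [^]\<^bsub>ZC\<^esub> n = \<one>\<^bsub>ZC\<^esub>"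
    by (auto simp: pow_ZC[OF d] fun_eq_iff fst_d snd_d)
  \<comment> \<open>Both components of \<open>d\<close> have trivial \<open>n\<close>-th power, so a
    second \<open>n\<close>-th power of \<open>c [^] n = d b\<close> leaves only a power of the
    coboundary \<open>b\<close>.\<close>
  have "c [^]\<^bsub>ZC\<^esub> (n * n) = (d \<otimes>\<^bsub>ZC\<^esub> b) [^]\<^bsub>ZC\<^esub> n"
    using c by (subst db) (simp add: ZC.nat_pow_pow)
  also have "\<dots> = d [^]\<^bsub>ZC\<^esub> n \<otimes>\<^bsub>ZC\<^esub> b [^]\<^bsub>ZC\<^esub> n"
    by (rule ZC.nat_pow_distrib) (use d bZ in simp_all)
  also have "\<dots> = b [^]\<^bsub>ZC\<^esub> n"
    unfolding dn by (rule ZC.l_one) (use bZ in \<open>intro ZC.nat_pow_closed; simp\<close>)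
  also have "\<dots> \<in> BC"
    using ZC.subgroup_int_pow_closed[OF B2b_subgroup b, of "int n"] by (simp add: int_pow_int)
  finally show ?thesis
    by (simp add: n_def)
qed

section \<open>The Schur multiplier: finiteness and a section\<close>

lemma finite_torsion_factor_sets:
  assumes fin: "finite (carrier A)" and n: "n > 0"
  shows "finite {c \<in> factor_sets A complex_units. c [^]\<^bsub>ZC\<^esub> (n::nat) = \<one>\<^bsub>ZC\<^esub>}"
proof (rule finite_subset)
  let ?I = "carrier A \<times> carrier A" and ?U = "{z::complex. z ^ n = 1}"
  show "finite ((?I \<rightarrow>\<^sub>E ?U) \<times> (?I \<rightarrow>\<^sub>E ?U))"
    using fin finite_roots_unity[of n] n by (intro finite_cartesian_product finite_PiE) auto
  show "{c \<in> factor_sets A complex_units. c [^]\<^bsub>ZC\<^esub> n = \<one>\<^bsub>ZC\<^esub>} \<subseteq> (?I \<rightarrow>\<^sub>E ?U) \<times> (?I \<rightarrow>\<^sub>E ?U)"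
  proof
    fix c assume "c \<in> {c \<in> factor_sets A complex_units. c [^]\<^bsub>ZC\<^esub> n = \<one>\<^bsub>ZC\<^esub>}"
    then obtain \<alpha> \<mu> where c_eq: "c = (\<alpha>, \<mu>)" and c: "(\<alpha>, \<mu>) \<in> factor_sets A complex_units"
      and "(\<alpha>, \<mu>) [^]\<^bsub>ZC\<^esub> n = \<one>\<^bsub>ZC\<^esub>"
      by (cases c) auto
    then have "(\<lambda>i\<in>?I. \<alpha> i ^ n) = (\<lambda>i\<in>?I. 1)" "(\<lambda>i\<in>?I. \<mu> i ^ n) = (\<lambda>i\<in>?I. 1)"
      by (simp_all add: pow_ZC)
    then have "\<alpha> i ^ n = 1" "\<mu> i ^ n = 1" if "i \<in> ?I" for i
      using that by (fastforce dest: fun_cong[of _ _ i])+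
    then show "c \<in> (?I \<rightarrow>\<^sub>E ?U) \<times> (?I \<rightarrow>\<^sub>E ?U)"
      using factor_set_PiE[OF c] by (auto simp: PiE_def c_eq)
  qed
qed

text \<open>The torsion factor sets \<open>F\<close> meet every coset of the coboundaries. They
  therefore bound the size of the quotient and also serve as the finite set of representatives from
  which the section is obtained.\<close>

lemma schur_multiplier_section:
  assumes fin: "finite (carrier A)"
  shows "comm_group (schur_multiplier A)" "finite (carrier (schur_multiplier A))"
    "\<exists>s\<in>hom (schur_multiplier A) ZC. \<forall>M\<in>carrier (schur_multiplier A). s M \<in> M"
proof -
  define N where "N = card (carrier A) * card (carrier A)"
  have N: "N > 0"
    using fin zero_mem by (auto simp: N_def card_gt_0_iff)
  define F where "F = {c \<in> factor_sets A complex_units. c [^]\<^bsub>ZC\<^esub> N = \<one>\<^bsub>ZC\<^esub>}"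
  have F: "finite F" "F \<subseteq> carrier ZC"
    using finite_torsion_factor_sets[OF fin N] by (auto simp: F_def)
  note Bsub = subgroup.subset[OF B2b_subgroup]
  have gen: "\<exists>y\<in>F. \<exists>b\<in>BC. c = y \<otimes>\<^bsub>ZC\<^esub> b" if c: "c \<in> carrier ZC" for c
  proof -
    have "c [^]\<^bsub>ZC\<^esub> N \<in> BC"
      using factor_set_pow_in_B2b[OF fin] c by (simp add: N_def)
    from B2b_divisible[OF this N] obtain b where b: "b \<in> BC" "b [^]\<^bsub>ZC\<^esub> N = c [^]\<^bsub>ZC\<^esub> N"
      by blast
    have bZ: "b \<in> carrier ZC" using b(1) Bsub by blast
    \<comment> \<open>Dividing \<open>c\<close> by an \<open>N\<close>-th root of the coboundary
      \<open>c [^] N\<close>, taken inside the coboundaries, gives an \<open>N\<close>-torsion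
      element of the same class.\<close>
    let ?y = "c \<otimes>\<^bsub>ZC\<^esub> inv\<^bsub>ZC\<^esub> b"
    have yZ: "?y \<in> carrier ZC"
      using c bZ by (intro ZC.m_closed ZC.inv_closed)
    have "?y [^]\<^bsub>ZC\<^esub> N = c [^]\<^bsub>ZC\<^esub> N \<otimes>\<^bsub>ZC\<^esub> inv\<^bsub>ZC\<^esub> (b [^]\<^bsub>ZC\<^esub> N)"
      using c bZ by (subst ZC.nat_pow_distrib) (simp_all only: ZC.inv_closed ZC.nat_pow_inv)
    also have "\<dots> = \<one>\<^bsub>ZC\<^esub>"
      unfolding b(2) using c by (intro ZC.r_inv ZC.nat_pow_closed)
    finally have "?y \<in> F"
      using yZ by (simp only: F_def mem_Collect_eq ZC_simps(1))
    moreover have "c = ?y \<otimes>\<^bsub>ZC\<^esub> b"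
      using c bZ by (metis ZC.inv_closed ZC.l_inv ZC.m_assoc ZC.r_one)
    ultimately show ?thesis
      using b(1) by blast
  qed
  have tors: "\<exists>n::nat. n > 0 \<and> c [^]\<^bsub>ZC\<^esub> n \<in> BC" if "c \<in> F" for c
    using that N subgroup.one_closed[OF B2b_subgroup]
    by (intro exI[of _ N]) (simp only: F_def mem_Collect_eq)
  have eq: "schur_multiplier A = ZC Mod BC"
    by (simp add: schur_multiplier_def H2b_def)
  show "comm_group (schur_multiplier A)"
    unfolding eq by (rule ZC.abelian_FactGroup[OF B2b_subgroup])
  show "\<exists>s\<in>hom (schur_multiplier A) ZC. \<forall>M\<in>carrier (schur_multiplier A). s M \<in> M"
    unfolding eq by (rule ZC.ex_hom_section[OF B2b_subgroup B2b_divisible F tors gen])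
  have "carrier (ZC Mod BC) \<subseteq> (\<lambda>y. BC #>\<^bsub>ZC\<^esub> y) ` F"
  proof
    fix M assume "M \<in> carrier (ZC Mod BC)"
    then obtain c where c: "c \<in> carrier ZC" "M = BC #>\<^bsub>ZC\<^esub> c"
      by (auto simp: carrier_FactGroup)
    obtain y b where y: "y \<in> F" "b \<in> BC" "c = y \<otimes>\<^bsub>ZC\<^esub> b"
      using gen[OF c(1)] by blast
    have yb: "y \<in> carrier ZC" "b \<in> carrier ZC" using y F Bsub by blast+
    have "c = b \<otimes>\<^bsub>ZC\<^esub> y"
      unfolding y(3) by (rule ZC.m_comm[OF yb])
    then have "c \<in> BC #>\<^bsub>ZC\<^esub> y"
      using y(2) unfolding r_coset_def by blast
    then have "BC #>\<^bsub>ZC\<^esub> y = BC #>\<^bsub>ZC\<^esub> c"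
      using yb(1) by (intro ZC.repr_independence[OF _ _ B2b_subgroup])
    then show "M \<in> (\<lambda>y. BC #>\<^bsub>ZC\<^esub> y) ` F"
      using c(2) y(1) by blast
  qed
  then show "finite (carrier (schur_multiplier A))"
    unfolding eq using F(1) by (meson finite_surj)
qed

end

section \<open>Extensions by factor sets\<close>

text \<open>The classical group attached to a normalised 2-cocycle. \<open>H\<close> is described by
  its operations rather than constructed, so that the result applies both to the additive and to the
  circle group of one skew brace.\<close>

lemma central_extension:
  fixes G (structure)
  assumes "comm_group K" "group G"
    and c_closed: "\<And>x y. x \<in> carrier G \<Longrightarrow> y \<in> carrier G \<Longrightarrow> c (x, y) \<in> carrier K"
    and c_one: "\<And>x. x \<in> carrier G \<Longrightarrow> c (\<one>, x) = \<one>\<^bsub>K\<^esub>" "\<And>x. x \<in> carrier G \<Longrightarrow> c (x, \<one>) = \<one>\<^bsub>K\<^esub>"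
    and cocycle: "\<And>x y z. x \<in> carrier G \<Longrightarrow> y \<in> carrier G \<Longrightarrow> z \<in> carrier G \<Longrightarrow>
      c (y, z) \<otimes>\<^bsub>K\<^esub> c (x, y \<otimes> z) = c (x \<otimes> y, z) \<otimes>\<^bsub>K\<^esub> c (x, y)"
    and H: "carrier H = carrier K \<times> carrier G" "\<one>\<^bsub>H\<^esub> = (\<one>\<^bsub>K\<^esub>, \<one>)"
      "\<And>p q. p \<otimes>\<^bsub>H\<^esub> q = (fst p \<otimes>\<^bsub>K\<^esub> fst q \<otimes>\<^bsub>K\<^esub> c (snd p, snd q), snd p \<otimes> snd q)"
  shows central_extension_group: "group H"
    and central_extension_inv: "\<And>a x. a \<in> carrier K \<Longrightarrow> x \<in> carrier G \<Longrightarrow>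
      inv\<^bsub>H\<^esub> (a, x) = (inv\<^bsub>K\<^esub> a \<otimes>\<^bsub>K\<^esub> inv\<^bsub>K\<^esub> c (inv x, x), inv x)"
proof -
  interpret K: comm_group K by fact
  interpret group G by fact
  have l_inv: "(inv\<^bsub>K\<^esub> a \<otimes>\<^bsub>K\<^esub> inv\<^bsub>K\<^esub> c (inv x, x), inv x) \<otimes>\<^bsub>H\<^esub> (a, x) = \<one>\<^bsub>H\<^esub>"
    if "a \<in> carrier K" "x \<in> carrier G" for a x
    using that by (simp add: H c_closed K.m_ac)
  show g: "group H"
  proof (rule groupI)
    fix p q r assume "p \<in> carrier H" "q \<in> carrier H" "r \<in> carrier H"
    then have mem: "fst p \<in> carrier K" "snd p \<in> carrier G" "fst q \<in> carrier K" "snd q \<in> carrier G"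
      "fst r \<in> carrier K" "snd r \<in> carrier G"
      by (auto simp: H)
    have "fst p \<otimes>\<^bsub>K\<^esub> fst q \<otimes>\<^bsub>K\<^esub> c (snd p, snd q) \<otimes>\<^bsub>K\<^esub> fst r \<otimes>\<^bsub>K\<^esub> c (snd p \<otimes> snd q, snd r) =
      fst p \<otimes>\<^bsub>K\<^esub> fst q \<otimes>\<^bsub>K\<^esub> fst r \<otimes>\<^bsub>K\<^esub> (c (snd p \<otimes> snd q, snd r) \<otimes>\<^bsub>K\<^esub> c (snd p, snd q))"
      using mem by (simp add: K.m_ac c_closed)
    also have "\<dots> = fst p \<otimes>\<^bsub>K\<^esub> (fst q \<otimes>\<^bsub>K\<^esub> fst r \<otimes>\<^bsub>K\<^esub> c (snd q, snd r)) \<otimes>\<^bsub>K\<^esub> c (snd p, snd q \<otimes> snd r)"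
      using mem by (subst cocycle[symmetric]) (simp_all add: K.m_ac c_closed)
    finally show "p \<otimes>\<^bsub>H\<^esub> q \<otimes>\<^bsub>H\<^esub> r = p \<otimes>\<^bsub>H\<^esub> (q \<otimes>\<^bsub>H\<^esub> r)"
      using mem by (simp add: H m_assoc)
  next
    fix p assume "p \<in> carrier H"
    then have mem: "fst p \<in> carrier K" "snd p \<in> carrier G"
      by (auto simp: H)
    show "\<one>\<^bsub>H\<^esub> \<otimes>\<^bsub>H\<^esub> p = p"
      using mem by (simp add: H c_one)
    show "\<exists>q\<in>carrier H. q \<otimes>\<^bsub>H\<^esub> p = \<one>\<^bsub>H\<^esub>"
      using l_inv[OF mem] mem
      by (intro bexI[of _ "(inv\<^bsub>K\<^esub> fst p \<otimes>\<^bsub>K\<^esub> inv\<^bsub>K\<^esub> c (inv snd p, snd p), inv snd p)"])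
        (simp_all add: H(1) c_closed)
  qed (auto simp: H c_closed)
  show "inv\<^bsub>H\<^esub> (a, x) = (inv\<^bsub>K\<^esub> a \<otimes>\<^bsub>K\<^esub> inv\<^bsub>K\<^esub> c (inv x, x), inv x)"
    if "a \<in> carrier K" "x \<in> carrier G" for a x
    using that by (intro group.inv_equality[OF g] l_inv) (simp_all add: H(1) c_closed)
qed

section \<open>The skew brace attached to a factor set\<close>

definition extension_brace ::
  "('k, 'l) monoid_scheme \<Rightarrow> ('a, 'm) ring_scheme \<Rightarrow> ('a \<times> 'a \<Rightarrow> 'k) \<Rightarrow> ('a \<times> 'a \<Rightarrow> 'k) \<Rightarrow> ('k \<times> 'a) ring"
  where "extension_brace K Q \<alpha> \<mu> =
    \<lparr>carrier = carrier K \<times> carrier Q,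
     monoid.mult = (\<lambda>p q. (fst p \<otimes>\<^bsub>K\<^esub> fst q \<otimes>\<^bsub>K\<^esub> \<mu> (snd p, snd q), snd p \<otimes>\<^bsub>Q\<^esub> snd q)),
     one = (\<one>\<^bsub>K\<^esub>, \<one>\<^bsub>Q\<^esub>),
     ring.zero = (\<one>\<^bsub>K\<^esub>, \<zero>\<^bsub>Q\<^esub>),
     ring.add = (\<lambda>p q. (fst p \<otimes>\<^bsub>K\<^esub> fst q \<otimes>\<^bsub>K\<^esub> \<alpha> (snd p, snd q), snd p \<oplus>\<^bsub>Q\<^esub> snd q))\<rparr>"

text \<open>The conditions of \<open>factor_sets\<close> without inverses and stated on the carrier
  only, which suits maps obtained by choosing a value at each pair.\<close>

locale brace_factor_set = Q: skew_brace Q + K: comm_group K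
  for Q :: "('a, 'm) ring_scheme" (structure) and K :: "('k, 'l) monoid_scheme"
    and \<alpha> \<mu> :: "'a \<times> 'a \<Rightarrow> 'k" +
  assumes closed [simp]: "\<And>x y. x \<in> carrier Q \<Longrightarrow> y \<in> carrier Q \<Longrightarrow> \<alpha> (x, y) \<in> carrier K"
      "\<And>x y. x \<in> carrier Q \<Longrightarrow> y \<in> carrier Q \<Longrightarrow> \<mu> (x, y) \<in> carrier K"
    and normalised [simp]: "\<And>x. x \<in> carrier Q \<Longrightarrow> \<alpha> (\<zero>, x) = \<one>\<^bsub>K\<^esub>" "\<And>x. x \<in> carrier Q \<Longrightarrow> \<alpha> (x, \<zero>) = \<one>\<^bsub>K\<^esub>"
      "\<And>x. x \<in> carrier Q \<Longrightarrow> \<mu> (\<zero>, x) = \<one>\<^bsub>K\<^esub>" "\<And>x. x \<in> carrier Q \<Longrightarrow> \<mu> (x, \<zero>) = \<one>\<^bsub>K\<^esub>"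
    and cocycle: "\<And>x y z. x \<in> carrier Q \<Longrightarrow> y \<in> carrier Q \<Longrightarrow> z \<in> carrier Q \<Longrightarrow>
        \<alpha> (y, z) \<otimes>\<^bsub>K\<^esub> \<alpha> (x, y \<oplus> z) = \<alpha> (x \<oplus> y, z) \<otimes>\<^bsub>K\<^esub> \<alpha> (x, y)"
      "\<And>x y z. x \<in> carrier Q \<Longrightarrow> y \<in> carrier Q \<Longrightarrow> z \<in> carrier Q \<Longrightarrow>
        \<mu> (y, z) \<otimes>\<^bsub>K\<^esub> \<mu> (x, y \<otimes> z) = \<mu> (x \<otimes> y, z) \<otimes>\<^bsub>K\<^esub> \<mu> (x, y)"
    and compatible: "\<And>x y z. x \<in> carrier Q \<Longrightarrow> y \<in> carrier Q \<Longrightarrow> z \<in> carrier Q \<Longrightarrow>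
        \<alpha> (y, z) \<otimes>\<^bsub>K\<^esub> \<mu> (x, y \<oplus> z) \<otimes>\<^bsub>K\<^esub> \<alpha> (\<ominus> x, x) =
        \<mu> (x, z) \<otimes>\<^bsub>K\<^esub> \<alpha> (x \<otimes> y, \<ominus> x) \<otimes>\<^bsub>K\<^esub> \<alpha> ((x \<otimes> y) \<ominus> x, x \<otimes> z) \<otimes>\<^bsub>K\<^esub> \<mu> (x, y)"
begin

abbreviation "E \<equiv> extension_brace K Q \<alpha> \<mu>"

lemma E_simps:
  "carrier E = carrier K \<times> carrier Q"
  "(a, x) \<otimes>\<^bsub>E\<^esub> (b, y) = (a \<otimes>\<^bsub>K\<^esub> b \<otimes>\<^bsub>K\<^esub> \<mu> (x, y), x \<otimes> y)"
  "(a, x) \<oplus>\<^bsub>E\<^esub> (b, y) = (a \<otimes>\<^bsub>K\<^esub> b \<otimes>\<^bsub>K\<^esub> \<alpha> (x, y), x \<oplus> y)"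
  "\<one>\<^bsub>E\<^esub> = (\<one>\<^bsub>K\<^esub>, \<zero>)" "\<zero>\<^bsub>E\<^esub> = (\<one>\<^bsub>K\<^esub>, \<zero>)"
  by (simp_all add: extension_brace_def Q.one_eq_zero)

lemma group_add_E: "group (add_monoid E)"
  and neg_E: "\<And>a x. a \<in> carrier K \<Longrightarrow> x \<in> carrier Q \<Longrightarrow>
    \<ominus>\<^bsub>E\<^esub> (a, x) = (inv\<^bsub>K\<^esub> a \<otimes>\<^bsub>K\<^esub> inv\<^bsub>K\<^esub> \<alpha> (\<ominus> x, x), \<ominus> x)"
  unfolding a_inv_def[of E] a_inv_def[of Q]
  by (rule central_extension[where c = \<alpha> and G = "add_monoid Q", OF K.comm_group_axioms Q.add.group_axioms];
      simp add: extension_brace_def cocycle(1))+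

lemma group_circ_E: "group E"
  by (rule central_extension[where c = \<mu> and G = Q, OF K.comm_group_axioms Q.circ.group_axioms];
      simp add: extension_brace_def cocycle(2) Q.one_eq_zero)

lemma brace_E: "skew_brace E"
proof -
  have distrib: "p \<otimes>\<^bsub>E\<^esub> (q \<oplus>\<^bsub>E\<^esub> r) = p \<otimes>\<^bsub>E\<^esub> q \<ominus>\<^bsub>E\<^esub> p \<oplus>\<^bsub>E\<^esub> p \<otimes>\<^bsub>E\<^esub> r"
    if p: "p \<in> carrier E" and q: "q \<in> carrier E" and r: "r \<in> carrier E" for p q r
  proof -
    obtain a x b y d z where pqr: "p = (a, x)" "q = (b, y)" "r = (d, z)"
      by (metis prod.exhaust)
    have mem: "a \<in> carrier K" "b \<in> carrier K" "d \<in> carrier K" "x \<in> carrier Q" "y \<in> carrier Q" "z \<in> carrier Q"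
      using p q r by (auto simp: pqr E_simps)
    let ?P = "\<alpha> (y, z)" and ?Q = "\<mu> (x, y \<oplus> z)" and ?R = "\<alpha> (\<ominus> x, x)" and ?S = "\<mu> (x, z)"
      and ?T = "\<alpha> (x \<otimes> y, \<ominus> x)" and ?U = "\<alpha> ((x \<otimes> y) \<ominus> x, x \<otimes> z)" and ?V = "\<mu> (x, y)"
    have cl: "?P \<in> carrier K" "?Q \<in> carrier K" "?R \<in> carrier K" "?S \<in> carrier K" "?T \<in> carrier K"
      "?U \<in> carrier K" "?V \<in> carrier K"
      using mem by simp_all
    \<comment> \<open>The term \<open>?R\<close> in the compatibility condition is the correction
      that appears inverted in the additive inverse of \<open>(a, x)\<close>. Moved to the other
      side it matches the term \<open>\<ominus> p\<close> in the distributive law.\<close>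
    have PQ: "?P \<otimes>\<^bsub>K\<^esub> ?Q = ?S \<otimes>\<^bsub>K\<^esub> ?T \<otimes>\<^bsub>K\<^esub> ?U \<otimes>\<^bsub>K\<^esub> ?V \<otimes>\<^bsub>K\<^esub> inv\<^bsub>K\<^esub> ?R"
      by (rule K.inv_solve_right[THEN iffD2]) (use mem in \<open>simp_all add: compatible\<close>)
    have "a \<otimes>\<^bsub>K\<^esub> (b \<otimes>\<^bsub>K\<^esub> d \<otimes>\<^bsub>K\<^esub> ?P) \<otimes>\<^bsub>K\<^esub> ?Q = (a \<otimes>\<^bsub>K\<^esub> inv\<^bsub>K\<^esub> a) \<otimes>\<^bsub>K\<^esub> (a \<otimes>\<^bsub>K\<^esub> b \<otimes>\<^bsub>K\<^esub> d \<otimes>\<^bsub>K\<^esub> (?P \<otimes>\<^bsub>K\<^esub> ?Q))"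
      using mem cl by (simp add: K.m_assoc)
    also have "\<dots> = (a \<otimes>\<^bsub>K\<^esub> b \<otimes>\<^bsub>K\<^esub> ?V \<otimes>\<^bsub>K\<^esub> (inv\<^bsub>K\<^esub> a \<otimes>\<^bsub>K\<^esub> inv\<^bsub>K\<^esub> ?R) \<otimes>\<^bsub>K\<^esub> ?T) \<otimes>\<^bsub>K\<^esub> (a \<otimes>\<^bsub>K\<^esub> d \<otimes>\<^bsub>K\<^esub> ?S) \<otimes>\<^bsub>K\<^esub> ?U"
      unfolding PQ using mem(1-3) cl by (simp only: K.m_ac K.m_closed K.inv_closed)
    finally show ?thesis
      using mem by (simp add: pqr E_simps neg_E a_minus_def[of E] Q.brace_distrib flip: a_minus_def[of Q])
  qed
  show ?thesis
    unfolding skew_brace_def skew_brace_axioms_def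
    using group_add_E group_circ_E distrib by blast
qed

lemma annihilator_extension_E: "annihilator_extension K (\<lambda>k. (k, \<zero>)) E snd Q"
proof -
  interpret E: skew_brace E by (rule brace_E)
  have "(\<lambda>k. (k, \<zero>)) ` carrier K \<subseteq> annihilator E"
  proof
    fix p assume "p \<in> (\<lambda>k. (k, \<zero>)) ` carrier K"
    then obtain k where k: "k \<in> carrier K" "p = (k, \<zero>)" by auto
    then have p: "p \<in> carrier E" by (simp add: E_simps)
    \<comment> \<open>Normalisation makes all four ways of combining \<open>(k, \<zero>)\<close>
      with \<open>q\<close> equal; the socle condition and both centralities follow at once.\<close>
    have *: "p \<otimes>\<^bsub>E\<^esub> q = p \<oplus>\<^bsub>E\<^esub> q \<and> q \<otimes>\<^bsub>E\<^esub> p = p \<oplus>\<^bsub>E\<^esub> q \<and> q \<oplus>\<^bsub>E\<^esub> p = p \<oplus>\<^bsub>E\<^esub> q"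
      if "q \<in> carrier E" for q
      using that k by (cases q) (simp add: E_simps K.m_comm)
    have "\<ominus>\<^bsub>E\<^esub> p \<oplus>\<^bsub>E\<^esub> (p \<otimes>\<^bsub>E\<^esub> q) = q" if "q \<in> carrier E" for q
      using *[OF that] p that by (simp flip: E.add_assoc)
    then show "p \<in> annihilator E"
      using p * by (simp add: annihilator_def socle_def group_centre_def)
  qed
  moreover have "(\<lambda>k. (k, \<zero>)) ` carrier K = kernel (add_monoid E) (add_monoid Q) snd"
    by (auto simp: kernel_def E_simps)
  moreover have "snd ` carrier E = carrier Q"
    using K.one_closed by (auto simp: E_simps image_iff)
  moreover have "snd \<in> skew_brace_hom E Q"
    by (auto simp: skew_brace_hom_def hom_def E_simps)
  moreover have "(\<lambda>k. (k, \<zero>)) \<in> skew_brace_hom (trivial_skew_brace K) E"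
    by (auto simp: skew_brace_hom_def trivial_skew_brace_def hom_def E_simps)
  ultimately show ?thesis
    unfolding annihilator_extension_def
    using K.comm_group_axioms brace_E Q.skew_brace_axioms by (simp add: inj_on_def)
qed

end

section \<open>The Schur cover\<close>

text \<open>The Schur multiplier consists of cosets of pairs of maps; transport along an enumeration
  replaces it by a kernel whose type is independent of \<open>Q\<close>.\<close>

lemma (in comm_group) ex_nat_copy:
  assumes fin: "finite (carrier G)"
  shows "\<exists>K :: nat monoid. comm_group K \<and> finite (carrier K) \<and> K \<cong> G"
proof -
  obtain g where g: "inj_on g (carrier G)" "g ` carrier G = {0..<card (carrier G)}"
    using ex_bij_betw_finite_nat[OF fin] by (auto simp: bij_betw_def)
  define u where "u = inv_into (carrier G) g"
  have u: "u (g x) = x" if "x \<in> carrier G" for x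
    using that g(1) by (simp add: u_def)
  define K where "K = \<lparr>carrier = g ` carrier G, monoid.mult = (\<lambda>a b. g (u a \<otimes> u b)), one = g \<one>\<rparr>"
  have "comm_group K"
    by (rule comm_groupI) (auto simp: K_def u m_ac, metis r_inv_ex)
  moreover have "g \<in> iso G K"
    using g(1) by (auto simp: iso_def hom_def bij_betw_def K_def u)
  then have "K \<cong> G"
    by (intro iso_sym) (auto simp: is_iso_def)
  ultimately show ?thesis
    using fin by (intro exI[of _ K]) (simp add: K_def)
qed

section \<open>Characters detecting the commutator\<close>

text \<open>\<open>d \<oplus> x\<close> and \<open>x \<oplus> d\<close> differ by an additive
  commutator, and all of these belong to the subgroup.\<close>

lemma (in skew_brace) brace_commutator_normal: "brace_commutator A \<lhd> add_monoid A"
proof (rule add.normalI)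
  let ?D = "brace_commutator A"
  have gens: "{add_commutator A a b | a b. a \<in> carrier A \<and> b \<in> carrier A}
      \<union> {star A a b | a b. a \<in> carrier A \<and> b \<in> carrier A} \<subseteq> carrier (add_monoid A)"
    by (auto simp: add_commutator_def star_def)
  show D: "subgroup ?D (add_monoid A)"
    unfolding brace_commutator_def by (rule add.generate_is_subgroup[OF gens])
  have comm: "add_commutator A a b \<in> ?D" if "a \<in> carrier A" "b \<in> carrier A" for a b
    using that unfolding brace_commutator_def by (intro generate.incl) auto
  show "\<forall>x\<in>carrier (add_monoid A). ?D #>\<^bsub>add_monoid A\<^esub> x = x <#\<^bsub>add_monoid A\<^esub> ?D"
  proof
    fix x assume "x \<in> carrier (add_monoid A)"
    then have x: "x \<in> carrier A" by simp
    have D_carr: "d \<in> carrier A" if "d \<in> ?D" for d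
      using subgroup.subset[OF D] that by auto
    have D_add: "d \<oplus> d' \<in> ?D" if "d \<in> ?D" "d' \<in> ?D" for d d'
      using subgroup.m_closed[OF D that] by simp
    show "?D #>\<^bsub>add_monoid A\<^esub> x = x <#\<^bsub>add_monoid A\<^esub> ?D"
    proof (intro equalityI subsetI)
      fix y assume "y \<in> ?D #>\<^bsub>add_monoid A\<^esub> x"
      then obtain d where d: "d \<in> ?D" "y = d \<oplus> x" by (auto simp: r_coset_def)
      have "y = x \<oplus> (add_commutator A (\<ominus> x) d \<oplus> d)"
        using d x D_carr[OF d(1)]
        by (simp add: add_commutator_def a_minus_def add_assoc add.inv_inv[folded a_inv_def, simplified])
          (simp flip: add_assoc)
      then show "y \<in> x <#\<^bsub>add_monoid A\<^esub> ?D"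
        using D_add[OF comm[of "\<ominus> x" d] d(1)] x D_carr[OF d(1)] by (auto simp: l_coset_def)
    next
      fix y assume "y \<in> x <#\<^bsub>add_monoid A\<^esub> ?D"
      then obtain d where d: "d \<in> ?D" "y = x \<oplus> d" by (auto simp: l_coset_def)
      have "y = (add_commutator A x d \<oplus> d) \<oplus> x"
        using d x D_carr[OF d(1)] by (simp add: add_commutator_def a_minus_def add_assoc)
      then show "y \<in> ?D #>\<^bsub>add_monoid A\<^esub> x"
        using D_add[OF comm[of x d] d(1)] x D_carr[OF d(1)] by (auto simp: r_coset_def)
    qed
  qed
qed

text \<open>The additive quotient by the commutator is a finite abelian group, so its pairing
  provides a character that is nontrivial at the coset of \<open>x\<close>.\<close>

lemma (in skew_brace) ex_character_outside_commutator:
  assumes fin: "finite (carrier A)" and x: "x \<in> carrier A" "x \<notin> brace_commutator A"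
  obtains f where "f \<in> hom (add_monoid A) complex_units" "f \<in> hom A complex_units" "f x \<noteq> 1"
proof -
  let ?D = "brace_commutator A" and ?P = "add_monoid A"
  interpret D: normal ?D ?P by (rule brace_commutator_normal)
  have in_D: "add_commutator A a b \<in> ?D" "star A a b \<in> ?D" if "a \<in> carrier A" "b \<in> carrier A" for a b
    using that unfolding brace_commutator_def by (blast intro: generate.incl)+
  have coset_mult: "(?D #>\<^bsub>?P\<^esub> a) <#>\<^bsub>?P\<^esub> (?D #>\<^bsub>?P\<^esub> b) = ?D #>\<^bsub>?P\<^esub> (a \<oplus> b)"
    if "a \<in> carrier A" "b \<in> carrier A" for a b
    using D.rcos_sum[of a b] that by simp
  have coset_eq: "?D #>\<^bsub>?P\<^esub> (d \<oplus> a) = ?D #>\<^bsub>?P\<^esub> a" if "d \<in> ?D" "a \<in> carrier A" for a d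
  proof -
    have "d \<oplus> a \<in> ?D #>\<^bsub>?P\<^esub> a"
      using that by (auto simp: r_coset_def)
    then show ?thesis
      using add.repr_independence[of "d \<oplus> a" ?D a] that D.subgroup_axioms by simp
  qed
  have "?D #>\<^bsub>?P\<^esub> (a \<oplus> b) = ?D #>\<^bsub>?P\<^esub> (b \<oplus> a)" if "a \<in> carrier A" "b \<in> carrier A" for a b
  proof -
    have "a \<oplus> b = add_commutator A a b \<oplus> (b \<oplus> a)"
      using that by (simp add: add_commutator_def a_minus_def add_assoc)
        (simp flip: add_assoc)
    then show ?thesis
      using coset_eq[OF in_D(1)[OF that], of "b \<oplus> a"] that by simp
  qed
  then have "comm_group (?P Mod ?D)"
    by (intro group.group_comm_groupI[OF D.factorgroup_is_group])
      (auto simp: carrier_FactGroup coset_mult)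
  moreover have "finite (carrier (?P Mod ?D))"
    using fin by (simp add: carrier_FactGroup)
  ultimately obtain \<gamma> where \<gamma>: "perfect_pairing (?P Mod ?D) \<gamma>"
    using ex_perfect_pairing by blast
  have coset_mem: "?D #>\<^bsub>?P\<^esub> a \<in> carrier (?P Mod ?D)" if "a \<in> carrier A" for a
    using that by (simp add: carrier_FactGroup)
  have "?D #>\<^bsub>?P\<^esub> x \<noteq> \<one>\<^bsub>?P Mod ?D\<^esub>"
    using x add.rcos_self[of x ?D] D.subgroup_axioms by auto
  then obtain y where y: "y \<in> carrier (?P Mod ?D)" "\<gamma> (?D #>\<^bsub>?P\<^esub> x) y \<noteq> 1"
    using perfect_pairingD(3)[OF \<gamma> coset_mem[OF x(1)]] by blast
  define f where "f a = \<gamma> y (?D #>\<^bsub>?P\<^esub> a)" for a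
  have f_add: "f (a \<oplus> b) = f a * f b" if "a \<in> carrier A" "b \<in> carrier A" for a b
    using hom_mult[OF perfect_pairingD(1)[OF \<gamma> y(1)] coset_mem[OF that(1)] coset_mem[OF that(2)]] that
    by (simp add: f_def coset_mult)
  have f_nz: "f a \<noteq> 0" if "a \<in> carrier A" for a
    using hom_in_carrier[OF perfect_pairingD(1)[OF \<gamma> y(1)] coset_mem[OF that]] by (simp add: f_def)
  have f_circ: "f (a \<otimes> b) = f a * f b" if ab: "a \<in> carrier A" "b \<in> carrier A" for a b
  proof -
    have st: "star A a b \<in> carrier A"
      using in_D(2)[OF ab] D.subset by auto
    \<comment> \<open>Modulo the commutator the two operations coincide, which upgrades an additive
      character to a character of the circle group.\<close>
    have "a \<otimes> b = a \<oplus> (star A a b \<oplus> b)"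
      using ab by (simp add: star_def a_minus_def add_assoc) (simp flip: add_assoc)
    then show ?thesis
      using ab st coset_eq[OF in_D(2)[OF ab] ab(2)] f_add[OF ab(1), of "star A a b \<oplus> b"]
      by (simp add: f_def)
  qed
  show ?thesis
  proof
    show "f \<in> hom (add_monoid A) complex_units"
      by (rule homI) (simp_all add: f_add f_nz)
    show "f \<in> hom A complex_units"
      by (rule homI) (simp_all add: f_circ f_nz)
    show "f x \<noteq> 1"
      using y perfect_pairingD(2)[OF \<gamma> y(1) coset_mem[OF x(1)]] by (simp add: f_def)
  qed
qed

text \<open>Tested against \<open>k\<close>, each condition on \<open>\<alpha>\<close> and
  \<open>\<mu>\<close> becomes the same condition on the complex factor set \<open>s k\<close>,
  where it is known to hold.\<close>

lemma brace_factor_set_lift: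
  assumes "skew_brace Q" "comm_group K" and \<beta>: "perfect_pairing K \<beta>"
    and s: "s \<in> hom K (Z2b Q complex_units)"
  obtains \<alpha> \<mu> where "brace_factor_set Q K \<alpha> \<mu>"
    "\<And>k x y. k \<in> carrier K \<Longrightarrow> x \<in> carrier Q \<Longrightarrow> y \<in> carrier Q \<Longrightarrow> \<beta> k (\<alpha> (x, y)) = fst (s k) (x, y)"
    "\<And>k x y. k \<in> carrier K \<Longrightarrow> x \<in> carrier Q \<Longrightarrow> y \<in> carrier Q \<Longrightarrow> \<beta> k (\<mu> (x, y)) = snd (s k) (x, y)"
proof -
  interpret Q: skew_brace Q by fact
  interpret K: comm_group K by fact
  let ?I = "carrier Q \<times> carrier Q"
  have sZ: "s k \<in> factor_sets Q complex_units" if "k \<in> carrier K" for k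
    using hom_in_carrier[OF s that] by simp
  have ev: "(\<lambda>k. fst (s k) i) \<in> hom K complex_units" "(\<lambda>k. snd (s k) i) \<in> hom K complex_units"
    if i: "i \<in> ?I" for i
    using i hom_mult[OF s] Q.factor_set_nz[OF sZ]
    by (auto simp: hom_def)
  have "\<exists>a\<in>carrier K. \<forall>k\<in>carrier K. fst (s k) i = \<beta> a k" if "i \<in> ?I" for i
    using perfect_pairingD(4)[OF \<beta> ev(1)[OF that]] .
  then obtain \<alpha> where \<alpha>: "\<And>i. i \<in> ?I \<Longrightarrow> \<alpha> i \<in> carrier K"
    "\<And>i k. i \<in> ?I \<Longrightarrow> k \<in> carrier K \<Longrightarrow> \<beta> (\<alpha> i) k = fst (s k) i"
    by metis
  have "\<exists>a\<in>carrier K. \<forall>k\<in>carrier K. snd (s k) i = \<beta> a k" if "i \<in> ?I" for i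
    using perfect_pairingD(4)[OF \<beta> ev(2)[OF that]] .
  then obtain \<mu> where \<mu>: "\<And>i. i \<in> ?I \<Longrightarrow> \<mu> i \<in> carrier K"
    "\<And>i k. i \<in> ?I \<Longrightarrow> k \<in> carrier K \<Longrightarrow> \<beta> (\<mu> i) k = snd (s k) i"
    by metis
  note eqI = K.perfect_pairing_eqI[OF \<beta>]
  note simps = \<alpha> \<mu> K.perfect_pairing_mult[OF \<beta>] K.perfect_pairing_one[OF \<beta>] Q.factor_set_normalised[OF sZ]
  have "brace_factor_set Q K \<alpha> \<mu>"
  proof (intro brace_factor_set.intro brace_factor_set_axioms.intro)
    fix x assume x: "x \<in> carrier Q"
    show "\<alpha> (\<zero>\<^bsub>Q\<^esub>, x) = \<one>\<^bsub>K\<^esub>" "\<alpha> (x, \<zero>\<^bsub>Q\<^esub>) = \<one>\<^bsub>K\<^esub>" "\<mu> (\<zero>\<^bsub>Q\<^esub>, x) = \<one>\<^bsub>K\<^esub>" "\<mu> (x, \<zero>\<^bsub>Q\<^esub>) = \<one>\<^bsub>K\<^esub>"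
      using x by (auto intro!: eqI simp: simps)
  next
    fix x y z assume x: "x \<in> carrier Q" and y: "y \<in> carrier Q" and z: "z \<in> carrier Q"
    show "\<alpha> (y, z) \<otimes>\<^bsub>K\<^esub> \<alpha> (x, y \<oplus>\<^bsub>Q\<^esub> z) = \<alpha> (x \<oplus>\<^bsub>Q\<^esub> y, z) \<otimes>\<^bsub>K\<^esub> \<alpha> (x, y)"
      using Q.factor_set_cocycle(1)[OF sZ x y z] x y z by (intro eqI) (simp_all add: simps)
    show "\<mu> (y, z) \<otimes>\<^bsub>K\<^esub> \<mu> (x, y \<otimes>\<^bsub>Q\<^esub> z) = \<mu> (x \<otimes>\<^bsub>Q\<^esub> y, z) \<otimes>\<^bsub>K\<^esub> \<mu> (x, y)"
      using Q.factor_set_cocycle(2)[OF sZ x y z] x y z by (intro eqI) (simp_all add: simps)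
    show "\<alpha> (y, z) \<otimes>\<^bsub>K\<^esub> \<mu> (x, y \<oplus>\<^bsub>Q\<^esub> z) \<otimes>\<^bsub>K\<^esub> \<alpha> (\<ominus>\<^bsub>Q\<^esub> x, x) =
        \<mu> (x, z) \<otimes>\<^bsub>K\<^esub> \<alpha> (x \<otimes>\<^bsub>Q\<^esub> y, \<ominus>\<^bsub>Q\<^esub> x) \<otimes>\<^bsub>K\<^esub> \<alpha> (x \<otimes>\<^bsub>Q\<^esub> y \<ominus>\<^bsub>Q\<^esub> x, x \<otimes>\<^bsub>Q\<^esub> z) \<otimes>\<^bsub>K\<^esub> \<mu> (x, y)"
      using Q.factor_set_cocycle(3)[OF sZ x y z] x y z by (intro eqI) (simp_all add: simps)
  qed (use \<alpha> \<mu> Q.skew_brace_axioms K.comm_group_axioms in auto)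
  moreover have "\<beta> k (\<alpha> (x, y)) = fst (s k) (x, y)" "\<beta> k (\<mu> (x, y)) = snd (s k) (x, y)"
    if "k \<in> carrier K" "x \<in> carrier Q" "y \<in> carrier Q" for k x y
    using that \<alpha> \<mu> perfect_pairingD(2)[OF \<beta> that(1)] by simp_all
  ultimately show ?thesis
    by (rule that)
qed

text \<open>Half of the exactness of restriction followed by transgression: a character of
  \<open>K\<close> that extends to \<open>E\<close> turns the factor set of \<open>E\<close> into a
  coboundary.\<close>

lemma (in brace_factor_set) character_restriction_coboundary:
  assumes f: "f \<in> hom (add_monoid E) complex_units" "f \<in> hom E complex_units"
  shows "\<exists>c\<in>B2b Q complex_units. \<forall>x\<in>carrier Q. \<forall>y\<in>carrier Q.
    fst c (x, y) = f (\<alpha> (x, y), \<zero>) \<and> snd c (x, y) = f (\<mu> (x, y), \<zero>)"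
    and "(\<lambda>k. f (k, \<zero>)) \<in> hom K complex_units"
proof -
  have nz: "f (k, x) \<noteq> 0" if "k \<in> carrier K" "x \<in> carrier Q" for k x
    using hom_in_carrier[OF f(2), of "(k, x)"] that by (simp add: E_simps)
  have f_add: "f (p \<oplus>\<^bsub>E\<^esub> q) = f p * f q" if "p \<in> carrier E" "q \<in> carrier E" for p q
    using hom_mult[OF f(1), of p q] that by simp
  have f_circ: "f (p \<otimes>\<^bsub>E\<^esub> q) = f p * f q" if "p \<in> carrier E" "q \<in> carrier E" for p q
    using hom_mult[OF f(2), of p q] that by simp
  show chi: "(\<lambda>k. f (k, \<zero>)) \<in> hom K complex_units"
    using f_add[of "(_, \<zero>)" "(_, \<zero>)"] by (intro homI) (simp_all add: nz E_simps)
  define h where "h x = f (\<one>\<^bsub>K\<^esub>, x)" for x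
  have split: "f (k, x) = f (k, \<zero>) * h x" if "k \<in> carrier K" "x \<in> carrier Q" for k x
    using f_add[of "(k, \<zero>)" "(\<one>\<^bsub>K\<^esub>, x)"] that by (simp add: E_simps h_def)
  have h: "h \<in> carrier Q \<rightarrow> - {0}" "h \<zero> = 1"
    using split[of "\<one>\<^bsub>K\<^esub>" \<zero>] nz[of "\<one>\<^bsub>K\<^esub>"] by (auto simp: h_def)
  \<comment> \<open>Both sides come from \<open>(\<one>, x) \<oplus> (\<one>, y) = (\<alpha> (x, y),
    x \<oplus> y)\<close>, whose right-hand side splits as \<open>(\<alpha> (x, y), \<zero>)\<close>
    plus \<open>(\<one>, x \<oplus> y)\<close>.\<close>
  have add: "f (\<alpha> (x, y), \<zero>) = h y * h x / h (x \<oplus> y)" if "x \<in> carrier Q" "y \<in> carrier Q" for x y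
    using f_add[of "(\<one>\<^bsub>K\<^esub>, x)" "(\<one>\<^bsub>K\<^esub>, y)"] split[of "\<alpha> (x, y)" "x \<oplus> y"] Pi_mem[OF h(1), of "x \<oplus> y"] that
    by (simp add: E_simps field_simps flip: h_def)
  have circ: "f (\<mu> (x, y), \<zero>) = h y * h x / h (x \<otimes> y)" if "x \<in> carrier Q" "y \<in> carrier Q" for x y
    using f_circ[of "(\<one>\<^bsub>K\<^esub>, x)" "(\<one>\<^bsub>K\<^esub>, y)"] split[of "\<mu> (x, y)" "x \<otimes> y"] Pi_mem[OF h(1), of "x \<otimes> y"] that
    by (simp add: E_simps field_simps flip: h_def)
  show "\<exists>c\<in>B2b Q complex_units. \<forall>x\<in>carrier Q. \<forall>y\<in>carrier Q.
    fst c (x, y) = f (\<alpha> (x, y), \<zero>) \<and> snd c (x, y) = f (\<mu> (x, y), \<zero>)"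
    by (rule bexI[OF _ Q.B2b_I[OF h]]) (simp add: add circ)
qed

theorem theorem3p4:
  fixes Q :: "'a ring"
  assumes "skew_brace Q" and "finite (carrier Q)"
  shows "\<exists>(K :: nat monoid) (\<iota> :: nat \<Rightarrow> nat \<times> 'a) (E :: (nat \<times> 'a) ring) (\<pi> :: nat \<times> 'a \<Rightarrow> 'a).
           schur_cover K \<iota> E \<pi> Q"
proof -
  interpret Q: skew_brace Q by fact
  let ?M = "schur_multiplier Q" and ?Z = "Z2b Q complex_units" and ?B = "B2b Q complex_units"
  interpret M: comm_group ?M by (rule Q.schur_multiplier_section(1)[OF assms(2)])
  obtain s where s: "s \<in> hom ?M ?Z" "\<And>m. m \<in> carrier ?M \<Longrightarrow> s m \<in> m"
    using Q.schur_multiplier_section(3)[OF assms(2)] by blast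
  obtain K :: "nat monoid" where K: "comm_group K" "finite (carrier K)" "K \<cong> ?M"
    using M.ex_nat_copy[OF Q.schur_multiplier_section(2)[OF assms(2)]] by blast
  interpret K: comm_group K by (rule K(1))
  obtain \<phi> where \<phi>: "\<phi> \<in> iso K ?M" using K(3) by (auto simp: is_iso_def)
  then have \<phi>_hom: "\<phi> \<in> hom K ?M" by (simp add: iso_def)
  define h where "h = s \<circ> \<phi>"
  have h: "h \<in> hom K ?Z"
    unfolding h_def by (rule hom_compose[OF \<phi>_hom s(1)])
  \<comment> \<open>\<open>h k\<close> represents the class \<open>\<phi> k\<close>, so a coboundary
    value means that this class is trivial, and \<open>\<phi>\<close> is injective.\<close>
  have h_B: "k = \<one>\<^bsub>K\<^esub>" if k: "k \<in> carrier K" and hB: "h k \<in> ?B" for k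
  proof -
    have mem: "\<phi> k \<in> carrier ?M" using \<phi>_hom k by (rule hom_in_carrier)
    then obtain c where c: "c \<in> carrier ?Z" "\<phi> k = ?B #>\<^bsub>?Z\<^esub> c"
      by (auto simp: schur_multiplier_def H2b_def carrier_FactGroup)
    have "h k \<in> ?B #>\<^bsub>?Z\<^esub> c"
      using s(2)[OF mem] c(2) by (simp add: h_def)
    then have "?B #>\<^bsub>?Z\<^esub> c = ?B #>\<^bsub>?Z\<^esub> h k"
      by (rule Q.ZC.repr_independence[OF _ c(1) Q.B2b_subgroup])
    also have "\<dots> = ?B"
      by (rule Q.ZC.coset_join2[OF _ Q.B2b_subgroup hB]) (rule hom_in_carrier[OF h k])
    finally have "\<phi> k = \<phi> \<one>\<^bsub>K\<^esub>"
      using c(2) hom_one[OF \<phi>_hom K.group_axioms M.group_axioms]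
      by (simp add: schur_multiplier_def H2b_def)
    then show ?thesis
      using \<phi> k by (auto simp: iso_def bij_betw_def dest: inj_onD)
  qed
  obtain \<beta> where \<beta>: "perfect_pairing K \<beta>"
    using ex_perfect_pairing[OF K(1,2)] by blast
  obtain \<alpha> \<mu> where fs: "brace_factor_set Q K \<alpha> \<mu>" and
    \<alpha>: "\<And>k x y. k \<in> carrier K \<Longrightarrow> x \<in> carrier Q \<Longrightarrow> y \<in> carrier Q \<Longrightarrow> \<beta> k (\<alpha> (x, y)) = fst (h k) (x, y)" and
    \<mu>: "\<And>k x y. k \<in> carrier K \<Longrightarrow> x \<in> carrier Q \<Longrightarrow> y \<in> carrier Q \<Longrightarrow> \<beta> k (\<mu> (x, y)) = snd (h k) (x, y)"
    by (rule brace_factor_set_lift[OF assms(1) K(1) \<beta> h]) blast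
  interpret E: brace_factor_set Q K \<alpha> \<mu> by (rule fs)
  interpret EB: skew_brace E.E by (rule E.brace_E)
  have "(k, \<zero>\<^bsub>Q\<^esub>) \<in> brace_commutator E.E" if k: "k \<in> carrier K" for k
  proof (rule ccontr)
    assume not_in: "(k, \<zero>\<^bsub>Q\<^esub>) \<notin> brace_commutator E.E"
    have "finite (carrier E.E)" "(k, \<zero>\<^bsub>Q\<^esub>) \<in> carrier E.E"
      using K(2) assms(2) k by (simp_all add: E.E_simps)
    then obtain f where f: "f \<in> hom (add_monoid E.E) complex_units" "f \<in> hom E.E complex_units"
      "f (k, \<zero>\<^bsub>Q\<^esub>) \<noteq> 1"
      using EB.ex_character_outside_commutator not_in by blast
    obtain m where m: "m \<in> carrier K" "\<And>k. k \<in> carrier K \<Longrightarrow> f (k, \<zero>\<^bsub>Q\<^esub>) = \<beta> m k"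
      using perfect_pairingD(4)[OF \<beta> E.character_restriction_coboundary(2)[OF f(1,2)]] by blast
    obtain c where c: "c \<in> ?B"
      "\<And>x y. x \<in> carrier Q \<Longrightarrow> y \<in> carrier Q \<Longrightarrow> fst c (x, y) = fst (h m) (x, y) \<and> snd c (x, y) = snd (h m) (x, y)"
      using E.character_restriction_coboundary(1)[OF f(1,2)] m \<alpha> \<mu> by auto
    have hm: "h m \<in> factor_sets Q complex_units"
      using hom_in_carrier[OF h m(1)] by simp
    have cZ: "c \<in> factor_sets Q complex_units"
      using subgroup.subset[OF Q.B2b_subgroup] c(1) by auto
    \<comment> \<open>So far \<open>c\<close> and \<open>h m\<close> agree only on the carrier; both
      are extensional, so they are equal as functions and \<open>h m\<close> is itself in
      \<open>?B\<close>.\<close>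
    have "fst c = fst (h m)"
      by (rule PiE_ext[OF Q.factor_set_PiE(1)[OF cZ] Q.factor_set_PiE(1)[OF hm]]) (use c(2) in auto)
    moreover have "snd c = snd (h m)"
      by (rule PiE_ext[OF Q.factor_set_PiE(2)[OF cZ] Q.factor_set_PiE(2)[OF hm]]) (use c(2) in auto)
    ultimately have "h m \<in> ?B"
      using c(1) by (metis prod.collapse)
    then have "m = \<one>\<^bsub>K\<^esub>" by (rule h_B[OF m(1)])
    then show False
      using f(3) m(2)[OF k] K.perfect_pairing_one[OF \<beta> k] by simp
  qed
  then have "schur_cover K (\<lambda>k. (k, \<zero>\<^bsub>Q\<^esub>)) E.E snd Q"
    unfolding schur_cover_def using E.annihilator_extension_E K(3) by auto
  then show ?thesis by blast
qed

end
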